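(* Let $R$ be a commutative ring and $M$ a flat $R$-module. Consider the following statements: (1) For all $R$-linear maps $v\colon R\to M$, $\mathrm{Pure}(v)$ is open in $\mathrm{Spec}(R)$. (2) For all $x\in M$, the collection of ideals $\{I: I=\sqrt I\text{ and }x\in IM\}$ of $R$ has a smallest element under inclusion. Equivalently, for any collection of radical ideals $\{I_\alpha\}_\alpha$ of $R$, $\bigcap_\alpha I_\alpha M=\left(\bigcap_\alpha I_\alpha\right)M$. Then (2) $\Rightarrow$ (1). Moreover, if $M_{\mathfrak p}$ is an Ohm-Rush $R_{\mathfrak p}$-module for all $\mathfrak p\in\mathrm{Spec}(R)$, then (1) $\Rightarrow$ (2).
   Context: All rings are commutative, not necessarily Noetherian. A map of $R$-modules $M\to N$ is pure if for every $R$-module $P$ the induced map $M\otimes_R P\to N\otimes_R P$ is injective. For a map $v$ of $R$-modules, $\mathrm{Pure}(v)$ is the set of $\mathfrak p\in\mathrm{Spec}(R)$ such that $v_{\mathfrak p}$ is a pure map of $R_{\mathfrak p}$-modules. A radical ideal is an ideal $I$ with $I=\sqrt I$ (the unit ideal included). For an $R$-module $M$ and $x\in M$, the content $c_M(x)$ is the intersection of all ideals $I$ of $R$ with $x\in IM$. $M$ is Ohm-Rush if $x\in c_M(x)M$ for all $x\in M$. *)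

theory Defs
  imports
    "HOL-Analysis.Abstract_Topology"
    "HOL-Algebra.Free_Abelian_Groups" "HOL-Algebra.Ideal" "HOL-Algebra.Module"
begin

section \<open>Modules, linear maps, ideals\<close>

definition linear_maps ::
  "('r, 'c) ring_scheme \<Rightarrow> ('r, 'm, 'd) module_scheme \<Rightarrow> ('r, 'n, 'e) module_scheme \<Rightarrow> ('m \<Rightarrow> 'n) set"
  where "linear_maps R M N =
    {f \<in> carrier M \<rightarrow> carrier N.
       (\<forall>x\<in>carrier M. \<forall>y\<in>carrier M. f (x \<oplus>\<^bsub>M\<^esub> y) = f x \<oplus>\<^bsub>N\<^esub> f y) \<and>
       (\<forall>a\<in>carrier R. \<forall>x\<in>carrier M. f (a \<odot>\<^bsub>M\<^esub> x) = a \<odot>\<^bsub>N\<^esub> f x)}"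

definition regular_module :: "('r, 'c) ring_scheme \<Rightarrow> ('r, 'r) module"
  where "regular_module R =
    \<lparr>carrier = carrier R, monoid.mult = monoid.mult R, one = one R,
     ring.zero = ring.zero R, add = add R, smult = monoid.mult R\<rparr>"

lemma linear_mapsD:
  assumes "f \<in> linear_maps R M N"
  shows "x \<in> carrier M \<Longrightarrow> f x \<in> carrier N"
    "x \<in> carrier M \<Longrightarrow> y \<in> carrier M \<Longrightarrow> f (x \<oplus>\<^bsub>M\<^esub> y) = f x \<oplus>\<^bsub>N\<^esub> f y"
    "a \<in> carrier R \<Longrightarrow> x \<in> carrier M \<Longrightarrow> f (a \<odot>\<^bsub>M\<^esub> x) = a \<odot>\<^bsub>N\<^esub> f x"
  using assms by (auto simp: linear_maps_def)

lemma regular_module_simps [simp]: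
  "carrier (regular_module R) = carrier R" "add (regular_module R) = add R"
  "ring.zero (regular_module R) = ring.zero R" "smult (regular_module R) = monoid.mult R"
  by (simp_all add: regular_module_def)

lemma (in cring) module_regular_module: "module R (regular_module R)"
proof (rule moduleI)
  show "abelian_group (regular_module R)"
    by (rule abelian_groupI) (auto simp: a_ac intro: bexI[of _ "\<ominus> _"] l_neg)
qed (auto simp: cring_axioms m_assoc l_distr r_distr)

definition ideal_smult :: "('r, 'm, 'd) module_scheme \<Rightarrow> 'r set \<Rightarrow> 'm set"
  where "ideal_smult M I = generate (add_monoid M) {a \<odot>\<^bsub>M\<^esub> x | a x. a \<in> I \<and> x \<in> carrier M}"

definition ideal_radical :: "('r, 'c) ring_scheme \<Rightarrow> 'r set \<Rightarrow> 'r set"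
  where "ideal_radical R I = {a \<in> carrier R. \<exists>n::nat. a [^]\<^bsub>R\<^esub> n \<in> I}"

definition radical_ideal :: "'r set \<Rightarrow> ('r, 'c) ring_scheme \<Rightarrow> bool"
  where "radical_ideal I R \<longleftrightarrow> ideal I R \<and> I = ideal_radical R I"

definition module_content :: "('r, 'c) ring_scheme \<Rightarrow> ('r, 'm, 'd) module_scheme \<Rightarrow> 'm \<Rightarrow> 'r set"
  where "module_content R M x = \<Inter>{I. ideal I R \<and> x \<in> ideal_smult M I}"

definition ohm_rush :: "('r, 'c) ring_scheme \<Rightarrow> ('r, 'm, 'd) module_scheme \<Rightarrow> bool"
  where "ohm_rush R M \<longleftrightarrow> (\<forall>x\<in>carrier M. x \<in> ideal_smult M (module_content R M x))"


section \<open>Tensor products, purity, flatness\<close>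

text \<open>
  The tensor product is the free abelian group on pairs modulo the bilinearity and balancing
  relations.  Only its underlying abelian group is constructed: injectivity of an induced map
  does not involve the scalar action.
\<close>

definition tensor_rels ::
  "('r, 'c) ring_scheme \<Rightarrow> ('r, 'm, 'd) module_scheme \<Rightarrow> ('r, 'p, 'e) module_scheme \<Rightarrow>
   (('m \<times> 'p) \<Rightarrow>\<^sub>0 int) set"
  where "tensor_rels R M P =
     {frag_of (x \<oplus>\<^bsub>M\<^esub> x', y) - (frag_of (x, y) + frag_of (x', y)) | x x' y.
        x \<in> carrier M \<and> x' \<in> carrier M \<and> y \<in> carrier P}
   \<union> {frag_of (x, y \<oplus>\<^bsub>P\<^esub> y') - (frag_of (x, y) + frag_of (x, y')) | x y y'.
        x \<in> carrier M \<and> y \<in> carrier P \<and> y' \<in> carrier P}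
   \<union> {frag_of (a \<odot>\<^bsub>M\<^esub> x, y) - frag_of (x, a \<odot>\<^bsub>P\<^esub> y) | a x y.
        a \<in> carrier R \<and> x \<in> carrier M \<and> y \<in> carrier P}"

abbreviation tensor_free ::
  "('r, 'm, 'd) module_scheme \<Rightarrow> ('r, 'p, 'e) module_scheme \<Rightarrow> (('m \<times> 'p) \<Rightarrow>\<^sub>0 int) monoid"
  where "tensor_free M P \<equiv> free_Abelian_group (carrier M \<times> carrier P)"

definition tensor_ker ::
  "('r, 'c) ring_scheme \<Rightarrow> ('r, 'm, 'd) module_scheme \<Rightarrow> ('r, 'p, 'e) module_scheme \<Rightarrow>
   (('m \<times> 'p) \<Rightarrow>\<^sub>0 int) set"
  where "tensor_ker R M P = generate (tensor_free M P) (tensor_rels R M P)"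

definition tensor ::
  "('r, 'c) ring_scheme \<Rightarrow> ('r, 'm, 'd) module_scheme \<Rightarrow> ('r, 'p, 'e) module_scheme \<Rightarrow>
   (('m \<times> 'p) \<Rightarrow>\<^sub>0 int) set monoid"
  where "tensor R M P = tensor_free M P Mod tensor_ker R M P"

abbreviation frag_push :: "('a \<Rightarrow> 'b) \<Rightarrow> ('a \<Rightarrow>\<^sub>0 int) \<Rightarrow> ('b \<Rightarrow>\<^sub>0 int)"
  where "frag_push h \<equiv> frag_extend (\<lambda>z. frag_of (h z))"

text \<open>
  For linear \<open>v\<close>, the cosets in the union below coincide (lemma \<open>tensor_map_coset\<close>), and
  \<open>tensor_map R M N P v\<close> is the map induced by \<open>v\<close> from the tensor product of \<open>M\<close> and \<open>P\<close> to
  that of \<open>N\<close> and \<open>P\<close>.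
\<close>

definition tensor_map ::
  "('r, 'c) ring_scheme \<Rightarrow> ('r, 'm, 'd) module_scheme \<Rightarrow> ('r, 'n, 'e) module_scheme \<Rightarrow>
   ('r, 'p, 'f) module_scheme \<Rightarrow> ('m \<Rightarrow> 'n) \<Rightarrow>
   (('m \<times> 'p) \<Rightarrow>\<^sub>0 int) set \<Rightarrow> (('n \<times> 'p) \<Rightarrow>\<^sub>0 int) set"
  where "tensor_map R M N P v C =
    (\<Union>c\<in>C. tensor_ker R N P #>\<^bsub>tensor_free N P\<^esub> frag_push (map_prod v id) c)"

text \<open>
  HOL cannot quantify over all types inside a formula, so the test modules in the next two
  definitions are those carried by the type \<open>(nat \<Rightarrow> 'r) set\<close>.  Every finitely generated
  \<open>R\<close>-module is isomorphic to one of these (send an element to the set of its coordinate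
  sequences with respect to a fixed finite generating family), and whether an element of a tensor
  product vanishes is decided in finitely generated submodules.  Hence nothing is lost: theorems
  \<open>pure_map_any\<close> and \<open>flat_module_any\<close> below derive injectivity for test modules on arbitrary
  types.
\<close>

type_synonym 'r univ = "(nat \<Rightarrow> 'r) set"

definition pure_map ::
  "('r, 'c) ring_scheme \<Rightarrow> ('r, 'm, 'd) module_scheme \<Rightarrow> ('r, 'n, 'e) module_scheme \<Rightarrow>
   ('m \<Rightarrow> 'n) \<Rightarrow> bool"
  where "pure_map R M N v \<longleftrightarrow>
    v \<in> linear_maps R M N \<and>
    (\<forall>P :: ('r, 'r univ) module. module R P \<longrightarrow>
       inj_on (tensor_map R M N P v) (carrier (tensor R M P)))"

definition flat_module :: "('r, 'c) ring_scheme \<Rightarrow> ('r, 'm, 'd) module_scheme \<Rightarrow> bool"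
  where "flat_module R M \<longleftrightarrow>
    module R M \<and>
    (\<forall>(N :: ('r, 'r univ) module) (N' :: ('r, 'r univ) module) f.
       module R N \<and> module R N' \<and> f \<in> linear_maps R N N' \<and> inj_on f (carrier N) \<longrightarrow>
       inj_on (tensor_map R N N' M f) (carrier (tensor R N M)))"


lemma frag_push_push: "frag_push f (frag_push g c) = frag_push (f \<circ> g) c"
  using frag_extend_compose[of "frag_of \<circ> f" g c] by (simp add: o_def)

lemma frag_push_cong: "(\<And>z. z \<in> Poly_Mapping.keys c \<Longrightarrow> f z = g z) \<Longrightarrow> frag_push f c = frag_push g c"
  by (simp add: frag_extend_def)

lemma frag_push_ident: "(\<And>z. z \<in> Poly_Mapping.keys c \<Longrightarrow> f z = z) \<Longrightarrow> frag_push f c = c"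
  using frag_push_cong[of c f "\<lambda>z. z"] frag_expansion[of c] by (simp add: eta_contract_eq)

lemma keys_frag_push: "Poly_Mapping.keys (frag_push f c) \<subseteq> f ` Poly_Mapping.keys c"
  using keys_frag_extend[of "\<lambda>z. frag_of (f z)" c] by auto

lemma keys_frag_rel:
  "Poly_Mapping.keys (frag_of a - (frag_of b + frag_of c)) \<subseteq> {a, b, c}"
  "Poly_Mapping.keys (frag_of a - frag_of b) \<subseteq> {a, b}"
  using keys_diff[of "frag_of a" "frag_of b + frag_of c"] keys_diff[of "frag_of a" "frag_of b"]
    keys_add[of "frag_of b" "frag_of c"] by auto

lemma tensor_rels_subset:
  assumes "module R M" "module R P"
  shows "tensor_rels R M P \<subseteq> carrier (tensor_free M P)"
proof -
  interpret M: module R M by fact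
  interpret P: module R P by fact
  show ?thesis
    unfolding tensor_rels_def subset_iff carrier_free_Abelian_group_iff
    by (auto dest!: subsetD[OF keys_frag_rel(1)] subsetD[OF keys_frag_rel(2)])
qed

lemma tensor_ker_subgroup:
  assumes "module R M" "module R P"
  shows "subgroup (tensor_ker R M P) (tensor_free M P)"
  unfolding tensor_ker_def
  by (rule group.generate_is_subgroup) (simp_all add: tensor_rels_subset[OF assms] del: carrier_free_Abelian_group_iff)

lemma tensor_ker_keys:
  assumes "module R M" "module R P" "c \<in> tensor_ker R M P"
  shows "Poly_Mapping.keys c \<subseteq> carrier M \<times> carrier P"
  using subgroup.mem_carrier[OF tensor_ker_subgroup] assms by fastforce

lemma tensor_ker_closed:
  assumes "module R M" "module R P"
  shows "0 \<in> tensor_ker R M P"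
    "c \<in> tensor_ker R M P \<Longrightarrow> d \<in> tensor_ker R M P \<Longrightarrow> c + d \<in> tensor_ker R M P"
    "c \<in> tensor_ker R M P \<Longrightarrow> - c \<in> tensor_ker R M P"
    "c \<in> tensor_ker R M P \<Longrightarrow> d \<in> tensor_ker R M P \<Longrightarrow> c - d \<in> tensor_ker R M P"
proof -
  note H = tensor_ker_subgroup[OF assms]
  show "0 \<in> tensor_ker R M P"
    and 1: "c \<in> tensor_ker R M P \<Longrightarrow> d \<in> tensor_ker R M P \<Longrightarrow> c + d \<in> tensor_ker R M P" for c d
    using subgroup.one_closed[OF H] subgroup.m_closed[OF H] by auto
  show 2: "c \<in> tensor_ker R M P \<Longrightarrow> - c \<in> tensor_ker R M P" for c
    using subgroup.m_inv_closed[OF H, of c] tensor_ker_keys[OF assms, of c] by simp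
  show "c \<in> tensor_ker R M P \<Longrightarrow> d \<in> tensor_ker R M P \<Longrightarrow> c - d \<in> tensor_ker R M P"
    using 1[of c "- d"] 2[of d] by simp
qed

lemma tensor_ker_rels: "c \<in> tensor_rels R M P \<Longrightarrow> c \<in> tensor_ker R M P"
  unfolding tensor_ker_def by (rule generate.incl)

lemma tensor_ker_induct [consumes 3, case_names zero rel add uminus]:
  assumes "module R M" "module R P" "c \<in> tensor_ker R M P"
    and "Q 0" "\<And>c. c \<in> tensor_rels R M P \<Longrightarrow> Q c"
    and "\<And>c d. Q c \<Longrightarrow> Q d \<Longrightarrow> Q (c + d)" "\<And>c. Q c \<Longrightarrow> Q (- c)"
  shows "Q c"
  using assms(3) unfolding tensor_ker_def
proof (induction rule: generate.induct)
  case (inv h)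
  then have "Poly_Mapping.keys h \<subseteq> carrier M \<times> carrier P"
    using subsetD[OF tensor_rels_subset[OF assms(1,2)]] unfolding carrier_free_Abelian_group_iff by blast
  with inv show ?case using assms(5,7) by simp
qed (use assms(4-6) in auto)

lemma tensor_ker_push:
  assumes "module R M" "module R P" "module R M'" "module R P'"
    and f: "f \<in> linear_maps R M M'" and g: "g \<in> linear_maps R P P'"
    and c: "c \<in> tensor_ker R M P"
  shows "frag_push (map_prod f g) c \<in> tensor_ker R M' P'"
  using assms(1,2) c
proof (induction rule: tensor_ker_induct)
  case (rel c)
  have "frag_push (map_prod f g) c \<in> tensor_rels R M' P'"
    using rel linear_mapsD[OF f] linear_mapsD[OF g] unfolding tensor_rels_def
    by (auto simp: frag_extend_diff frag_extend_add) metis+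
  then show ?case by (rule tensor_ker_rels)
qed (auto simp: frag_extend_add frag_extend_minus intro!: tensor_ker_closed assms)

lemma coset_eq_iff:
  assumes "module R M" "module R P"
  shows "tensor_ker R M P #>\<^bsub>tensor_free M P\<^esub> c = tensor_ker R M P #>\<^bsub>tensor_free M P\<^esub> d
    \<longleftrightarrow> c - d \<in> tensor_ker R M P"
proof -
  note cl = tensor_ker_closed[OF assms]
  have mem: "x \<in> tensor_ker R M P #>\<^bsub>tensor_free M P\<^esub> c \<longleftrightarrow> x - c \<in> tensor_ker R M P" for x c
    by (auto simp: r_coset_def) (metis diff_add_cancel)
  show ?thesis
  proof
    assume "tensor_ker R M P #>\<^bsub>tensor_free M P\<^esub> c = tensor_ker R M P #>\<^bsub>tensor_free M P\<^esub> d"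
    then show "c - d \<in> tensor_ker R M P" using mem[of c c] mem[of c d] cl(1) by simp
  next
    assume *: "c - d \<in> tensor_ker R M P"
    have "x - c \<in> tensor_ker R M P \<longleftrightarrow> x - d \<in> tensor_ker R M P" for x
      using cl(2)[of "x - c" "c - d"] cl(4)[of "x - d" "c - d"] * by auto
    then show "tensor_ker R M P #>\<^bsub>tensor_free M P\<^esub> c = tensor_ker R M P #>\<^bsub>tensor_free M P\<^esub> d"
      using mem by blast
  qed
qed

lemma carrier_tensor:
  "carrier (tensor R M P) = {tensor_ker R M P #>\<^bsub>tensor_free M P\<^esub> c | c.
     Poly_Mapping.keys c \<subseteq> carrier M \<times> carrier P}"
  by (auto simp: tensor_def FactGroup_def RCOSETS_def)

lemma id_linear: "(\<lambda>x. x) \<in> linear_maps R P P" "id \<in> linear_maps R P P"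
  by (auto simp: linear_maps_def)

lemma tensor_map_coset:
  assumes "module R M" "module R N" "module R P" "v \<in> linear_maps R M N"
  shows "tensor_map R M N P v (tensor_ker R M P #>\<^bsub>tensor_free M P\<^esub> c)
    = tensor_ker R N P #>\<^bsub>tensor_free N P\<^esub> frag_push (map_prod v id) c"
  unfolding tensor_map_def
proof (rule SUP_eq_const)
  show "tensor_ker R M P #>\<^bsub>tensor_free M P\<^esub> c \<noteq> {}"
    using tensor_ker_closed(1)[of R M P] assms by (auto simp: r_coset_def)
  fix d assume "d \<in> tensor_ker R M P #>\<^bsub>tensor_free M P\<^esub> c"
  then obtain k where k: "k \<in> tensor_ker R M P" "d = k + c" by (auto simp: r_coset_def)
  have "frag_push (map_prod v id) k \<in> tensor_ker R N P"
    by (rule tensor_ker_push[OF assms(1,3,2,3,4) id_linear(2) k(1)])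
  then show "tensor_ker R N P #>\<^bsub>tensor_free N P\<^esub> frag_push (map_prod v id) d
    = tensor_ker R N P #>\<^bsub>tensor_free N P\<^esub> frag_push (map_prod v id) c"
    using assms by (simp add: coset_eq_iff k(2) frag_extend_add)
qed

lemma inj_on_tensor_map_iff:
  fixes M :: "('r, 'b, 'd) module_scheme" and P :: "('r, 'f, 'e) module_scheme"
  assumes "module R M" "module R N" "module R P" "v \<in> linear_maps R M N"
  shows "inj_on (tensor_map R M N P v) (carrier (tensor R M P)) \<longleftrightarrow>
    (\<forall>c. Poly_Mapping.keys c \<subseteq> carrier M \<times> carrier P \<longrightarrow>
       frag_push (map_prod v id) c \<in> tensor_ker R N P \<longrightarrow> c \<in> tensor_ker R M P)"
    (is "?L \<longleftrightarrow> ?R")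
proof
  assume L: ?L
  show ?R
  proof (intro allI impI)
    fix c assume c: "Poly_Mapping.keys c \<subseteq> carrier M \<times> carrier P"
      and k: "frag_push (map_prod v id) c \<in> tensor_ker R N P"
    have "tensor_map R M N P v (tensor_ker R M P #>\<^bsub>tensor_free M P\<^esub> c)
      = tensor_map R M N P v (tensor_ker R M P #>\<^bsub>tensor_free M P\<^esub> 0)"
      using assms k by (simp add: tensor_map_coset coset_eq_iff)
    then have "tensor_ker R M P #>\<^bsub>tensor_free M P\<^esub> c = tensor_ker R M P #>\<^bsub>tensor_free M P\<^esub> 0"
    proof (rule inj_onD[OF L])
      show "tensor_ker R M P #>\<^bsub>tensor_free M P\<^esub> c \<in> carrier (tensor R M P)"
        using c unfolding carrier_tensor by blast
      have "Poly_Mapping.keys (0 :: ('b \<times> 'f) \<Rightarrow>\<^sub>0 int) \<subseteq> carrier M \<times> carrier P" by simp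
      then show "tensor_ker R M P #>\<^bsub>tensor_free M P\<^esub> 0 \<in> carrier (tensor R M P)"
        unfolding carrier_tensor by blast
    qed
    then show "c \<in> tensor_ker R M P" using assms by (simp add: coset_eq_iff)
  qed
next
  assume R: ?R
  show ?L
  proof (rule inj_onI)
    fix C D assume "C \<in> carrier (tensor R M P)" "D \<in> carrier (tensor R M P)"
      and eq: "tensor_map R M N P v C = tensor_map R M N P v D"
    then obtain c d where c: "C = tensor_ker R M P #>\<^bsub>tensor_free M P\<^esub> c" "Poly_Mapping.keys c \<subseteq> carrier M \<times> carrier P"
      and d: "D = tensor_ker R M P #>\<^bsub>tensor_free M P\<^esub> d" "Poly_Mapping.keys d \<subseteq> carrier M \<times> carrier P"
      by (auto simp: carrier_tensor)
    have "frag_push (map_prod v id) (c - d) \<in> tensor_ker R N P"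
      using eq assms by (simp add: c(1) d(1) tensor_map_coset coset_eq_iff frag_extend_diff)
    moreover have "Poly_Mapping.keys (c - d) \<subseteq> carrier M \<times> carrier P"
      using keys_diff[of c d] c(2) d(2) by blast
    ultimately show "C = D" using R assms by (simp add: c(1) d(1) coset_eq_iff)
  qed
qed

lemma tensor_ker_finite_support:
  assumes "module R M" "module R P" "c \<in> tensor_ker R M P"
  shows "\<exists>A B. finite A \<and> finite B \<and> A \<subseteq> carrier M \<and> B \<subseteq> carrier P \<and>
    (\<forall>H K. submodule H R M \<longrightarrow> submodule K R P \<longrightarrow> A \<subseteq> H \<longrightarrow> B \<subseteq> K \<longrightarrow>
      c \<in> tensor_ker R (M\<lparr>carrier := H\<rparr>) (P\<lparr>carrier := K\<rparr>))"
  using assms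
proof (induction rule: tensor_ker_induct)
  case zero
  show ?case
    by (rule exI[of _ "{}"], rule exI[of _ "{}"]) (simp add: tensor_ker_closed assms submodule.submodule_is_module)
next
  case (rel c)
  then obtain x x' y y' where "x \<in> carrier M" "x' \<in> carrier M" "y \<in> carrier P" "y' \<in> carrier P"
    and *: "\<And>H K. {x, x'} \<subseteq> H \<Longrightarrow> {y, y'} \<subseteq> K \<Longrightarrow> c \<in> tensor_rels R (M\<lparr>carrier := H\<rparr>) (P\<lparr>carrier := K\<rparr>)"
  proof -
    assume t: "\<And>x x' y y'. x \<in> carrier M \<Longrightarrow> x' \<in> carrier M \<Longrightarrow> y \<in> carrier P \<Longrightarrow> y' \<in> carrier P \<Longrightarrow>
       (\<And>H K. {x, x'} \<subseteq> H \<Longrightarrow> {y, y'} \<subseteq> K \<Longrightarrow> c \<in> tensor_rels R (M\<lparr>carrier := H\<rparr>) (P\<lparr>carrier := K\<rparr>)) \<Longrightarrow> thesis"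
    consider (a) x x' y where "c = frag_of (x \<oplus>\<^bsub>M\<^esub> x', y) - (frag_of (x, y) + frag_of (x', y))"
        "x \<in> carrier M" "x' \<in> carrier M" "y \<in> carrier P"
      | (b) x y y' where "c = frag_of (x, y \<oplus>\<^bsub>P\<^esub> y') - (frag_of (x, y) + frag_of (x, y'))"
        "x \<in> carrier M" "y \<in> carrier P" "y' \<in> carrier P"
      | (s) a x y where "c = frag_of (a \<odot>\<^bsub>M\<^esub> x, y) - frag_of (x, a \<odot>\<^bsub>P\<^esub> y)"
        "a \<in> carrier R" "x \<in> carrier M" "y \<in> carrier P"
      using rel unfolding tensor_rels_def by blast
    then show thesis
    proof cases
      case a show ?thesis by (rule t[of x x' y y]) (use a in \<open>auto simp: tensor_rels_def\<close>)
    next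
      case b show ?thesis by (rule t[of x x y y']) (use b in \<open>auto simp: tensor_rels_def\<close>)
    next
      case s show ?thesis by (rule t[of x x y y]) (use s in \<open>auto simp: tensor_rels_def\<close>)
    qed
  qed
  then show ?case
    by (intro exI[of _ "{x, x'}"] exI[of _ "{y, y'}"]) (auto intro!: tensor_ker_rels)
next
  case (add c d)
  obtain A B where "finite A" "finite B" "A \<subseteq> carrier M" "B \<subseteq> carrier P"
    and 1: "\<And>H K. submodule H R M \<Longrightarrow> submodule K R P \<Longrightarrow> A \<subseteq> H \<Longrightarrow> B \<subseteq> K \<Longrightarrow>
      c \<in> tensor_ker R (M\<lparr>carrier := H\<rparr>) (P\<lparr>carrier := K\<rparr>)"
    using add(1) by auto
  moreover obtain A' B' where "finite A'" "finite B'" "A' \<subseteq> carrier M" "B' \<subseteq> carrier P"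
    and 2: "\<And>H K. submodule H R M \<Longrightarrow> submodule K R P \<Longrightarrow> A' \<subseteq> H \<Longrightarrow> B' \<subseteq> K \<Longrightarrow>
      d \<in> tensor_ker R (M\<lparr>carrier := H\<rparr>) (P\<lparr>carrier := K\<rparr>)"
    using add(2) by auto
  ultimately show ?case
    by (intro exI[of _ "A \<union> A'"] exI[of _ "B \<union> B'"])
      (auto intro!: tensor_ker_closed(2) 1 2 simp: assms submodule.submodule_is_module)
next
  case (uminus c)
  then show ?case
    by (metis assms(1,2) submodule.submodule_is_module tensor_ker_closed(3))
qed

primrec lin_comb :: "('r, 'm, 'd) module_scheme \<Rightarrow> 'm list \<Rightarrow> (nat \<Rightarrow> 'r) \<Rightarrow> 'm"
  where "lin_comb M [] a = \<zero>\<^bsub>M\<^esub>"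
  | "lin_comb M (s # ss) a = a 0 \<odot>\<^bsub>M\<^esub> s \<oplus>\<^bsub>M\<^esub> lin_comb M ss (\<lambda>i. a (Suc i))"

lemma fin_gen_embedding:
  fixes R :: "('r, 'c) ring_scheme" and M :: "('r, 'm, 'd) module_scheme"
  assumes "module R M" "finite A" "A \<subseteq> carrier M"
  shows "\<exists>H (\<phi> :: 'm \<Rightarrow> 'r univ). submodule H R M \<and> A \<subseteq> H \<and> inj_on \<phi> H"
proof -
  interpret module R M by fact
  obtain ss where ss: "set ss = A" using finite_list[OF assms(2)] by blast
  define C where "C = {a :: nat \<Rightarrow> 'r. \<forall>i. a i \<in> carrier R}"
  define H where "H = lin_comb M ss ` C"
  have cl: "lin_comb M ss a \<in> carrier M" if "a \<in> C" "set ss \<subseteq> carrier M" for ss a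
    using that by (induction ss arbitrary: a) (auto simp: C_def)
  have add: "lin_comb M ss (\<lambda>i. a i \<oplus>\<^bsub>R\<^esub> b i) = lin_comb M ss a \<oplus>\<^bsub>M\<^esub> lin_comb M ss b"
    if "a \<in> C" "b \<in> C" "set ss \<subseteq> carrier M" for ss a b
    using that
  proof (induction ss arbitrary: a b)
    case (Cons s ss)
    have C: "(\<lambda>i. a (Suc i)) \<in> C" "(\<lambda>i. b (Suc i)) \<in> C" using Cons.prems by (auto simp: C_def)
    then show ?case using Cons cl[OF C(1), of ss] cl[OF C(2), of ss] Cons.IH[OF C]
      by (simp add: smult_l_distr M.a_ac C_def)
  qed simp
  have smult: "lin_comb M ss (\<lambda>i. r \<otimes>\<^bsub>R\<^esub> a i) = r \<odot>\<^bsub>M\<^esub> lin_comb M ss a"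
    if "r \<in> carrier R" "a \<in> C" "set ss \<subseteq> carrier M" for ss r a
    using that
  proof (induction ss arbitrary: a)
    case (Cons s ss)
    have C: "(\<lambda>i. a (Suc i)) \<in> C" using Cons.prems by (auto simp: C_def)
    then show ?case using Cons cl[OF C(1), of ss] Cons.IH[OF _ C]
      by (simp add: smult_r_distr smult_assoc1 C_def)
  qed simp
  have zero: "lin_comb M ss (\<lambda>i. \<zero>\<^bsub>R\<^esub>) = \<zero>\<^bsub>M\<^esub>" if "set ss \<subseteq> carrier M" for ss
    using that by (induction ss) auto
  have mem: "s \<in> lin_comb M ss ` C" if "s \<in> set ss" "set ss \<subseteq> carrier M" for s ss
    using that
  proof (induction ss)
    case (Cons t ss)
    show ?case
    proof (cases "s = t")
      case True
      then have "s = lin_comb M (t # ss) (\<lambda>i. case i of 0 \<Rightarrow> \<one>\<^bsub>R\<^esub> | _ \<Rightarrow> \<zero>\<^bsub>R\<^esub>)"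
        using Cons.prems zero[of ss] by simp
      moreover have "(\<lambda>i. case i of 0 \<Rightarrow> \<one>\<^bsub>R\<^esub> | _ \<Rightarrow> \<zero>\<^bsub>R\<^esub>) \<in> C"
        by (auto simp: C_def split: nat.split)
      ultimately show ?thesis by (metis image_eqI)
    next
      case False
      then obtain a where a: "a \<in> C" "s = lin_comb M ss a" using Cons by auto
      then have "s = lin_comb M (t # ss) (\<lambda>i. case i of 0 \<Rightarrow> \<zero>\<^bsub>R\<^esub> | Suc j \<Rightarrow> a j)"
        using Cons.prems cl[of a ss] by simp
      moreover have "(\<lambda>i. case i of 0 \<Rightarrow> \<zero>\<^bsub>R\<^esub> | Suc j \<Rightarrow> a j) \<in> C"
        using a by (auto simp: C_def split: nat.split)
      ultimately show ?thesis by (metis image_eqI)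
    qed
  qed simp
  have S: "set ss \<subseteq> carrier M" using ss assms by simp
  have "submodule H R M"
  proof (rule submoduleI)
    show "H \<subseteq> carrier M" using cl S by (auto simp: H_def)
    have "(\<lambda>i. \<zero>\<^bsub>R\<^esub>) \<in> C" by (simp add: C_def)
    then show "\<zero>\<^bsub>M\<^esub> \<in> H" using zero[OF S] unfolding H_def by (metis image_eqI)
    show sm: "r \<odot>\<^bsub>M\<^esub> x \<in> H" if "r \<in> carrier R" "x \<in> H" for r x
    proof -
      obtain a where a: "a \<in> C" "x = lin_comb M ss a" using \<open>x \<in> H\<close> by (auto simp: H_def)
      then have "(\<lambda>i. r \<otimes>\<^bsub>R\<^esub> a i) \<in> C" using that by (auto simp: C_def)
      then show ?thesis using smult[OF that(1) a(1) S] a(2) unfolding H_def by (metis image_eqI)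
    qed
    show "x \<oplus>\<^bsub>M\<^esub> y \<in> H" if "x \<in> H" "y \<in> H" for x y
    proof -
      from that obtain a b where a: "a \<in> C" "x = lin_comb M ss a" "b \<in> C" "y = lin_comb M ss b"
        unfolding H_def by blast
      then have "(\<lambda>i. a i \<oplus>\<^bsub>R\<^esub> b i) \<in> C" by (auto simp: C_def)
      then show ?thesis using add[OF a(1,3) S] a unfolding H_def by (metis image_eqI)
    qed
    show "\<ominus>\<^bsub>M\<^esub> x \<in> H" if "x \<in> H" for x
    proof -
      have "x \<in> carrier M" using that cl S by (auto simp: H_def)
      then show ?thesis using sm[of "\<ominus>\<^bsub>R\<^esub> \<one>\<^bsub>R\<^esub>" x] that by (simp add: smult_l_minus)
    qed
  qed
  moreover have "A \<subseteq> H" using mem[OF _ S] ss by (auto simp: H_def)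
  moreover have "inj_on (\<lambda>y. {a \<in> C. lin_comb M ss a = y}) H"
    by (rule inj_onI) (auto simp: H_def)
  ultimately show ?thesis by blast
qed

definition transport_module ::
  "('r, 'm, 'd) module_scheme \<Rightarrow> ('m \<Rightarrow> 'n) \<Rightarrow> ('r, 'n) module"
  where "transport_module M \<phi> = (let \<psi> = the_inv_into (carrier M) \<phi> in
    \<lparr>carrier = \<phi> ` carrier M, monoid.mult = undefined, one = undefined, ring.zero = \<phi> \<zero>\<^bsub>M\<^esub>,
     add = (\<lambda>x y. \<phi> (\<psi> x \<oplus>\<^bsub>M\<^esub> \<psi> y)), smult = (\<lambda>a x. \<phi> (a \<odot>\<^bsub>M\<^esub> \<psi> x))\<rparr>)"

lemma transport_module:
  assumes "module R M" "inj_on \<phi> (carrier M)"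
  shows "module R (transport_module M \<phi>)"
    and "\<phi> \<in> linear_maps R M (transport_module M \<phi>)"
    and "the_inv_into (carrier M) \<phi> \<in> linear_maps R (transport_module M \<phi>) M"
proof -
  interpret module R M by fact
  note [simp] = the_inv_into_f_f[OF assms(2)]
  show "module R (transport_module M \<phi>)"
  proof (rule moduleI)
    show "cring R" by (rule R.is_cring)
    show "abelian_group (transport_module M \<phi>)"
      by (rule abelian_groupI)
        (auto simp: transport_module_def Let_def M.a_ac M.l_neg M.r_neg intro!: bexI[of _ "\<ominus>\<^bsub>M\<^esub> _"])
  qed (auto simp: transport_module_def Let_def smult_l_distr smult_r_distr smult_assoc1)
  show "\<phi> \<in> linear_maps R M (transport_module M \<phi>)"
    "the_inv_into (carrier M) \<phi> \<in> linear_maps R (transport_module M \<phi>) M"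
    by (auto simp: linear_maps_def transport_module_def Let_def)
qed

lemma inclusion_linear: "submodule H R M \<Longrightarrow> id \<in> linear_maps R (M\<lparr>carrier := H\<rparr>) M"
  by (auto simp: linear_maps_def submodule_def dest: subgroup.mem_carrier)

theorem pure_map_any:
  fixes R :: "('r, 'c) ring_scheme" and M :: "('r, 'm, 'd) module_scheme"
    and N :: "('r, 'n, 'e) module_scheme" and P :: "('r, 'p, 'f) module_scheme"
  assumes M: "module R M" and N: "module R N" and P: "module R P" and v: "pure_map R M N v"
  shows "inj_on (tensor_map R M N P v) (carrier (tensor R M P))"
proof -
  have vl: "v \<in> linear_maps R M N" using v by (simp add: pure_map_def)
  show ?thesis unfolding inj_on_tensor_map_iff[OF M N P vl]
  proof (intro allI impI)
    fix c assume c: "Poly_Mapping.keys c \<subseteq> carrier M \<times> carrier P"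
      and k: "frag_push (map_prod v id) c \<in> tensor_ker R N P"
    obtain A B where B: "finite B" "B \<subseteq> carrier P" and A: "A \<subseteq> carrier N"
      and AB: "\<And>H K. submodule H R N \<Longrightarrow> submodule K R P \<Longrightarrow> A \<subseteq> H \<Longrightarrow> B \<subseteq> K \<Longrightarrow>
        frag_push (map_prod v id) c \<in> tensor_ker R (N\<lparr>carrier := H\<rparr>) (P\<lparr>carrier := K\<rparr>)"
      using tensor_ker_finite_support[OF N P k] by blast
    have supp: "frag_push (map_prod v id) c \<in> tensor_ker R N (P\<lparr>carrier := K\<rparr>)"
      if "submodule K R P" "B \<subseteq> K" for K
      using AB[OF module.carrier_is_submodule[OF N] that(1) A that(2)] by simp
    obtain K and \<phi> :: "'p \<Rightarrow> 'r univ" where K: "submodule K R P" "B \<union> snd ` Poly_Mapping.keys c \<subseteq> K" "inj_on \<phi> K"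
      using fin_gen_embedding[OF P, of "B \<union> snd ` Poly_Mapping.keys c"] B c by fastforce
    let ?P = "P\<lparr>carrier := K\<rparr>"
    have P': "module R ?P" using submodule.submodule_is_module[OF K(1) P] .
    let ?T = "transport_module ?P \<phi>" and ?\<psi> = "the_inv_into (carrier ?P) \<phi>"
    have T: "module R ?T" "\<phi> \<in> linear_maps R ?P ?T" "?\<psi> \<in> linear_maps R ?T ?P"
      using transport_module[OF P', of \<phi>] K(3) by auto
    let ?d = "frag_push (map_prod id \<phi>) c"
    have keys: "Poly_Mapping.keys c \<subseteq> carrier M \<times> K" using c K(2) by force
    have "frag_push (map_prod id \<phi>) (frag_push (map_prod v id) c) \<in> tensor_ker R N ?T"
      using tensor_ker_push[OF N P' N T(1) id_linear(2) T(2)] supp[OF K(1)] K(2) by auto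
    also have "frag_push (map_prod id \<phi>) (frag_push (map_prod v id) c) = frag_push (map_prod v id) ?d"
      by (simp add: frag_push_push map_prod_compose[symmetric])
    finally have "frag_push (map_prod v id) ?d \<in> tensor_ker R N ?T" .
    moreover have "Poly_Mapping.keys ?d \<subseteq> carrier M \<times> carrier ?T"
      using keys_frag_push[of "map_prod id \<phi>" c] keys linear_mapsD(1)[OF T(2)] by fastforce
    moreover have "inj_on (tensor_map R M N ?T v) (carrier (tensor R M ?T))"
      using v T(1) by (simp add: pure_map_def)
    ultimately have "?d \<in> tensor_ker R M ?T"
      unfolding inj_on_tensor_map_iff[OF M N T(1) vl] by blast
    then have "frag_push (map_prod id ?\<psi>) ?d \<in> tensor_ker R M ?P"
      by (rule tensor_ker_push[OF M T(1) M P' id_linear(2) T(3)])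
    moreover have "frag_push (map_prod id ?\<psi>) ?d = c"
      unfolding frag_push_push
      by (rule frag_push_ident) (use keys K(3) in \<open>auto simp: the_inv_into_f_f\<close>)
    ultimately have "frag_push (map_prod id id) c \<in> tensor_ker R M P"
      using tensor_ker_push[OF M P' M P id_linear(2) inclusion_linear[OF K(1)]] by metis
    then show "c \<in> tensor_ker R M P" using frag_push_ident[of c "map_prod id id"] by (simp only: map_prod.id id_apply simp_thms)
  qed
qed

theorem flat_module_any:
  fixes R :: "('r, 'c) ring_scheme" and M :: "('r, 'm, 'd) module_scheme"
    and N :: "('r, 'n, 'e) module_scheme" and N' :: "('r, 'p, 'f) module_scheme"
  assumes M: "flat_module R M" and N: "module R N" and N': "module R N'"
    and f: "f \<in> linear_maps R N N'" and inj: "inj_on f (carrier N)"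
  shows "inj_on (tensor_map R N N' M f) (carrier (tensor R N M))"
proof -
  have M': "module R M" using M by (simp add: flat_module_def)
  interpret N: module R N by fact
  interpret N': module R N' by fact
  show ?thesis unfolding inj_on_tensor_map_iff[OF N N' M' f]
  proof (intro allI impI)
    fix c assume c: "Poly_Mapping.keys c \<subseteq> carrier N \<times> carrier M"
      and k: "frag_push (map_prod f id) c \<in> tensor_ker R N' M"
    obtain B A where B: "finite B" "B \<subseteq> carrier N'" and A: "A \<subseteq> carrier M"
      and AB: "\<And>H K. submodule H R N' \<Longrightarrow> submodule K R M \<Longrightarrow> B \<subseteq> H \<Longrightarrow> A \<subseteq> K \<Longrightarrow>
        frag_push (map_prod f id) c \<in> tensor_ker R (N'\<lparr>carrier := H\<rparr>) (M\<lparr>carrier := K\<rparr>)"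
      using tensor_ker_finite_support[OF N' M' k] by blast
    have supp: "frag_push (map_prod f id) c \<in> tensor_ker R (N'\<lparr>carrier := K\<rparr>) M"
      if "submodule K R N'" "B \<subseteq> K" for K
      using AB[OF that(1) module.carrier_is_submodule[OF M'] that(2) A] by simp
    have fc: "f ` fst ` Poly_Mapping.keys c \<subseteq> carrier N'" 
    proof -
      have "f (fst z) \<in> carrier N'" if "z \<in> Poly_Mapping.keys c" for z
        using that c linear_mapsD(1)[OF f, of "fst z"] by (cases z) auto
      then show ?thesis by blast
    qed
    have fin: "finite (B \<union> f ` fst ` Poly_Mapping.keys c)" "B \<union> f ` fst ` Poly_Mapping.keys c \<subseteq> carrier N'"
      using B fc by simp_all
    obtain K' and \<phi> :: "'p \<Rightarrow> 'r univ" where K': "submodule K' R N'"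
      "B \<union> f ` fst ` Poly_Mapping.keys c \<subseteq> K'" "inj_on \<phi> K'"
      using fin_gen_embedding[OF N' fin] by blast
    note K'D = N'.submoduleE[OF K'(1)]
    define K where "K = {x \<in> carrier N. f x \<in> K'}"
    have f0: "f \<zero>\<^bsub>N\<^esub> = \<zero>\<^bsub>N'\<^esub>"
      using linear_mapsD[OF f] by (metis N.R.zero_closed N.M.zero_closed N.smult_l_null N'.smult_l_null)
    have fm: "f (\<ominus>\<^bsub>N\<^esub> x) = \<ominus>\<^bsub>N'\<^esub> f x" if "x \<in> carrier N" for x
      using linear_mapsD[OF f] that N.smult_l_minus[of "\<one>\<^bsub>R\<^esub>" x] N'.smult_l_minus[of "\<one>\<^bsub>R\<^esub>" "f x"]
        linear_mapsD(3)[OF f, of "\<ominus>\<^bsub>R\<^esub> \<one>\<^bsub>R\<^esub>" x] by simp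
    have z: "\<zero>\<^bsub>N'\<^esub> \<in> K'"
      using K'(1) unfolding submodule_def by (auto dest: subgroup.one_closed)
    have K: "submodule K R N"
      by (rule N.submoduleI) (auto simp: K_def f0 fm z K'D linear_mapsD[OF f])
    let ?N = "N\<lparr>carrier := K\<rparr>" and ?N' = "N'\<lparr>carrier := K'\<rparr>"
    have KN: "module R ?N" "module R ?N'"
      using submodule.submodule_is_module K K'(1) N N' by auto
    have injK: "inj_on (\<phi> \<circ> f) K"
      using inj K'(3) by (auto simp: K_def inj_on_def)
    let ?T = "transport_module ?N (\<phi> \<circ> f)" and ?\<psi> = "the_inv_into (carrier ?N) (\<phi> \<circ> f)"
    let ?T' = "transport_module ?N' \<phi>"
    have T: "module R ?T" "\<phi> \<circ> f \<in> linear_maps R ?N ?T" "?\<psi> \<in> linear_maps R ?T ?N"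
      using transport_module[OF KN(1), of "\<phi> \<circ> f"] injK by auto
    have T': "module R ?T'" "\<phi> \<in> linear_maps R ?N' ?T'"
      using transport_module[OF KN(2), of \<phi>] K'(3) by auto
    have cT: "carrier ?T = (\<phi> \<circ> f) ` K" by (simp add: transport_module_def Let_def)
    have \<psi>: "?\<psi> ((\<phi> \<circ> f) x) = x" if "x \<in> K" for x
      using the_inv_into_f_f[OF injK that] by simp
    have idT: "id \<in> linear_maps R ?T ?T'"
    proof -
      have "\<phi> (f (x \<oplus>\<^bsub>N\<^esub> y)) = \<phi> (f x) \<oplus>\<^bsub>?T'\<^esub> \<phi> (f y)" if "x \<in> K" "y \<in> K" for x y
        using that linear_mapsD(2)[OF T'(2), of "f x" "f y"] linear_mapsD(2)[OF f, of x y] by (simp add: K_def)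
      moreover have "\<phi> (f (a \<odot>\<^bsub>N\<^esub> x)) = a \<odot>\<^bsub>?T'\<^esub> \<phi> (f x)" if "x \<in> K" "a \<in> carrier R" for a x
        using that linear_mapsD(3)[OF T'(2), of a "f x"] linear_mapsD(3)[OF f, of a x] by (simp add: K_def)
      moreover have "\<phi> (f x) \<in> carrier ?T'" if "x \<in> K" for x
        using that linear_mapsD(1)[OF T'(2), of "f x"] by (simp add: K_def)
      moreover have "\<phi> (f x) \<oplus>\<^bsub>?T\<^esub> \<phi> (f y) = \<phi> (f (x \<oplus>\<^bsub>N\<^esub> y))" if "x \<in> K" "y \<in> K" for x y
        using linear_mapsD(2)[OF T(2), of x y] that by simp
      moreover have "a \<odot>\<^bsub>?T\<^esub> \<phi> (f x) = \<phi> (f (a \<odot>\<^bsub>N\<^esub> x))" if "x \<in> K" "a \<in> carrier R" for a x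
        using linear_mapsD(3)[OF T(2), of a x] that by simp
      ultimately show ?thesis unfolding linear_maps_def cT by auto
    qed
    let ?d = "frag_push (map_prod (\<phi> \<circ> f) id) c"
    have keys: "Poly_Mapping.keys c \<subseteq> K \<times> carrier M" using c K'(2) by (force simp: K_def)
    have "frag_push (map_prod \<phi> id) (frag_push (map_prod f id) c) \<in> tensor_ker R ?T' M"
      using tensor_ker_push[OF KN(2) M' T'(1) M' T'(2) id_linear(2)] supp[OF K'(1)] K'(2) by auto
    also have "frag_push (map_prod \<phi> id) (frag_push (map_prod f id) c) = frag_push (map_prod id id) ?d"
      by (simp add: frag_push_push map_prod_compose[symmetric])
    finally have "frag_push (map_prod id id) ?d \<in> tensor_ker R ?T' M" .
    moreover have "Poly_Mapping.keys ?d \<subseteq> carrier ?T \<times> carrier M"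
      using keys_frag_push[of "map_prod (\<phi> \<circ> f) id" c] keys unfolding cT by fastforce
    moreover have "inj_on (tensor_map R ?T ?T' M id) (carrier (tensor R ?T M))"
      using M T(1) T'(1) idT by (simp add: flat_module_def)
    ultimately have "?d \<in> tensor_ker R ?T M"
      unfolding inj_on_tensor_map_iff[OF T(1) T'(1) M' idT] by blast
    then have "frag_push (map_prod ?\<psi> id) ?d \<in> tensor_ker R ?N M"
      by (rule tensor_ker_push[OF T(1) M' KN(1) M' T(3) id_linear(2)])
    moreover have "frag_push (map_prod ?\<psi> id) ?d = c"
      unfolding frag_push_push
      by (rule frag_push_ident) (use keys \<psi> in auto)
    ultimately have "frag_push (map_prod id id) c \<in> tensor_ker R N M"
      using tensor_ker_push[OF KN(1) M' N M' inclusion_linear[OF K] id_linear(2)] by metis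
    then show "c \<in> tensor_ker R N M" using frag_push_ident[of c "map_prod id id"] by (simp only: map_prod.id id_apply simp_thms)
  qed
qed


section \<open>Localization\<close>

definition loc_rel ::
  "('r, 'c) ring_scheme \<Rightarrow> ('r, 'm, 'd) module_scheme \<Rightarrow> 'r set \<Rightarrow> (('m \<times> 'r) \<times> ('m \<times> 'r)) set"
  where "loc_rel R M S =
    {((x, s), (y, t)) | x s y t.
       x \<in> carrier M \<and> y \<in> carrier M \<and> s \<in> S \<and> t \<in> S \<and>
       (\<exists>u\<in>S. u \<odot>\<^bsub>M\<^esub> (t \<odot>\<^bsub>M\<^esub> x) = u \<odot>\<^bsub>M\<^esub> (s \<odot>\<^bsub>M\<^esub> y))}"

definition loc_frac ::
  "('r, 'c) ring_scheme \<Rightarrow> ('r, 'm, 'd) module_scheme \<Rightarrow> 'r set \<Rightarrow> 'm \<Rightarrow> 'r \<Rightarrow> ('m \<times> 'r) set"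
  where "loc_frac R M S x s = loc_rel R M S `` {(x, s)}"

text \<open>
  Operations on fractions are unions over all representatives; the united classes coincide
  (lemmas \<open>loc_add\<close>, \<open>loc_smult\<close>, \<open>loc_mult\<close>, \<open>loc_map_frac\<close>).
\<close>

definition loc_ring :: "('r, 'c) ring_scheme \<Rightarrow> 'r set \<Rightarrow> ('r \<times> 'r) set ring"
  where "loc_ring R S =
    \<lparr>carrier = (carrier R \<times> S) // loc_rel R (regular_module R) S,
     monoid.mult = (\<lambda>V W. \<Union>(a, s)\<in>V. \<Union>(b, t)\<in>W. loc_frac R (regular_module R) S (a \<otimes>\<^bsub>R\<^esub> b) (s \<otimes>\<^bsub>R\<^esub> t)),
     one = loc_frac R (regular_module R) S \<one>\<^bsub>R\<^esub> \<one>\<^bsub>R\<^esub>,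
     ring.zero = loc_frac R (regular_module R) S \<zero>\<^bsub>R\<^esub> \<one>\<^bsub>R\<^esub>,
     add = (\<lambda>V W. \<Union>(a, s)\<in>V. \<Union>(b, t)\<in>W.
        loc_frac R (regular_module R) S (t \<otimes>\<^bsub>R\<^esub> a \<oplus>\<^bsub>R\<^esub> s \<otimes>\<^bsub>R\<^esub> b) (s \<otimes>\<^bsub>R\<^esub> t))\<rparr>"

text \<open>A module record also has multiplication fields; these play no role in a module.\<close>

definition loc_module ::
  "('r, 'c) ring_scheme \<Rightarrow> ('r, 'm, 'd) module_scheme \<Rightarrow> 'r set \<Rightarrow>
   (('r \<times> 'r) set, ('m \<times> 'r) set) module"
  where "loc_module R M S =
    \<lparr>carrier = (carrier M \<times> S) // loc_rel R M S,
     monoid.mult = undefined,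
     one = undefined,
     ring.zero = loc_frac R M S \<zero>\<^bsub>M\<^esub> \<one>\<^bsub>R\<^esub>,
     add = (\<lambda>V W. \<Union>(x, s)\<in>V. \<Union>(y, t)\<in>W.
        loc_frac R M S (t \<odot>\<^bsub>M\<^esub> x \<oplus>\<^bsub>M\<^esub> s \<odot>\<^bsub>M\<^esub> y) (s \<otimes>\<^bsub>R\<^esub> t)),
     smult = (\<lambda>V W. \<Union>(a, s)\<in>V. \<Union>(y, t)\<in>W. loc_frac R M S (a \<odot>\<^bsub>M\<^esub> y) (s \<otimes>\<^bsub>R\<^esub> t))\<rparr>"

definition loc_map ::
  "('r, 'c) ring_scheme \<Rightarrow> ('r, 'n, 'e) module_scheme \<Rightarrow> 'r set \<Rightarrow> ('m \<Rightarrow> 'n) \<Rightarrow>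
   ('m \<times> 'r) set \<Rightarrow> ('n \<times> 'r) set"
  where "loc_map R N S v V = (\<Union>(x, s)\<in>V. loc_frac R N S (v x) s)"


lemma UN_const2:
  assumes "(a, s) \<in> V" "(b, t) \<in> W"
    and "\<And>a' s' b' t'. (a', s') \<in> V \<Longrightarrow> (b', t') \<in> W \<Longrightarrow> f a' s' b' t' = C"
  shows "(\<Union>(a, s)\<in>V. \<Union>(b, t)\<in>W. f a s b t) = C"
proof (rule SUP_eq_const)
  fix p assume "p \<in> V"
  then show "(case p of (a, s) \<Rightarrow> \<Union>(b, t)\<in>W. f a s b t) = C"
    using assms(2,3) by (cases p) (auto intro!: SUP_eq_const)
qed (use assms(1) in auto)

locale mod_loc = module R M for R :: "('r,'c) ring_scheme" (structure) and M :: "('r,'m,'d) module_scheme" (structure) +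
  fixes S :: "'r set"
  assumes S_sub: "S \<subseteq> carrier R" and S_one: "\<one>\<^bsub>R\<^esub> \<in> S"
    and S_mult: "\<And>s t. s \<in> S \<Longrightarrow> t \<in> S \<Longrightarrow> s \<otimes>\<^bsub>R\<^esub> t \<in> S"
begin

lemma S_carrier [simp]: "s \<in> S \<Longrightarrow> s \<in> carrier R" using S_sub by blast

declare S_one [simp] S_mult [simp]

lemma smult_lcomm:
  "a \<in> carrier R \<Longrightarrow> b \<in> carrier R \<Longrightarrow> x \<in> carrier M \<Longrightarrow>
   a \<odot>\<^bsub>M\<^esub> (b \<odot>\<^bsub>M\<^esub> x) = b \<odot>\<^bsub>M\<^esub> (a \<odot>\<^bsub>M\<^esub> x)"
  by (metis smult_assoc1 R.m_comm)

lemma loc_rel_iff: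
  "((x, s), (y, t)) \<in> loc_rel R M S \<longleftrightarrow> x \<in> carrier M \<and> y \<in> carrier M \<and> s \<in> S \<and> t \<in> S \<and>
       (\<exists>u\<in>S. u \<odot>\<^bsub>M\<^esub> (t \<odot>\<^bsub>M\<^esub> x) = u \<odot>\<^bsub>M\<^esub> (s \<odot>\<^bsub>M\<^esub> y))"
  by (simp add: loc_rel_def)

lemma equiv_loc_rel: "equiv (carrier M \<times> S) (loc_rel R M S)"
proof (rule equivI)
  show "loc_rel R M S \<subseteq> (carrier M \<times> S) \<times> (carrier M \<times> S)" by (auto simp: loc_rel_def)
  show "refl_on (carrier M \<times> S) (loc_rel R M S)"
    by (auto simp: refl_on_def loc_rel_iff)
  show "sym_on UNIV (loc_rel R M S)"
    by (auto simp: sym_on_def loc_rel_iff) metis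
  show "trans_on UNIV (loc_rel R M S)"
  proof (rule transI, clarsimp simp: loc_rel_iff)
    fix x s y t z r u v
    assume c: "x \<in> carrier M" "y \<in> carrier M" "z \<in> carrier M" "s \<in> S" "t \<in> S" "r \<in> S" "u \<in> S" "v \<in> S"
      and 1: "u \<odot>\<^bsub>M\<^esub> (t \<odot>\<^bsub>M\<^esub> x) = u \<odot>\<^bsub>M\<^esub> (s \<odot>\<^bsub>M\<^esub> y)"
      and 2: "v \<odot>\<^bsub>M\<^esub> (r \<odot>\<^bsub>M\<^esub> y) = v \<odot>\<^bsub>M\<^esub> (t \<odot>\<^bsub>M\<^esub> z)"
    have "(u \<otimes>\<^bsub>R\<^esub> v \<otimes>\<^bsub>R\<^esub> t) \<odot>\<^bsub>M\<^esub> (r \<odot>\<^bsub>M\<^esub> x) = v \<odot>\<^bsub>M\<^esub> (r \<odot>\<^bsub>M\<^esub> (u \<odot>\<^bsub>M\<^esub> (t \<odot>\<^bsub>M\<^esub> x)))"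
      using c by (simp add: smult_assoc1[symmetric] R.m_ac)
    also have "\<dots> = u \<odot>\<^bsub>M\<^esub> (s \<odot>\<^bsub>M\<^esub> (v \<odot>\<^bsub>M\<^esub> (r \<odot>\<^bsub>M\<^esub> y)))"
      unfolding 1 using c by (simp add: smult_assoc1[symmetric] R.m_ac)
    also have "\<dots> = (u \<otimes>\<^bsub>R\<^esub> v \<otimes>\<^bsub>R\<^esub> t) \<odot>\<^bsub>M\<^esub> (s \<odot>\<^bsub>M\<^esub> z)"
      unfolding 2 using c by (simp add: smult_assoc1[symmetric] R.m_ac)
    finally show "\<exists>u\<in>S. u \<odot>\<^bsub>M\<^esub> (r \<odot>\<^bsub>M\<^esub> x) = u \<odot>\<^bsub>M\<^esub> (s \<odot>\<^bsub>M\<^esub> z)"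
      using c by (metis S_mult)
  qed
qed

lemma frac_eq_iff:
  assumes "x \<in> carrier M" "y \<in> carrier M" "s \<in> S" "t \<in> S"
  shows "loc_frac R M S x s = loc_frac R M S y t \<longleftrightarrow> (\<exists>u\<in>S. u \<odot>\<^bsub>M\<^esub> (t \<odot>\<^bsub>M\<^esub> x) = u \<odot>\<^bsub>M\<^esub> (s \<odot>\<^bsub>M\<^esub> y))"
  using eq_equiv_class_iff[OF equiv_loc_rel, of "(x, s)" "(y, t)"] assms
  by (simp add: loc_frac_def loc_rel_iff)

lemma frac_eqI:
  assumes "x \<in> carrier M" "y \<in> carrier M" "s \<in> S" "t \<in> S" "t \<odot>\<^bsub>M\<^esub> x = s \<odot>\<^bsub>M\<^esub> y"
  shows "loc_frac R M S x s = loc_frac R M S y t"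
  using assms by (subst frac_eq_iff) auto

lemma mem_frac_iff:
  assumes "x \<in> carrier M" "s \<in> S"
  shows "(y, t) \<in> loc_frac R M S x s \<longleftrightarrow> y \<in> carrier M \<and> t \<in> S \<and> loc_frac R M S y t = loc_frac R M S x s"
proof -
  have "(y, t) \<in> loc_frac R M S x s \<longleftrightarrow> ((x, s), (y, t)) \<in> loc_rel R M S" by (simp add: loc_frac_def)
  then show ?thesis using assms frac_eq_iff[of y x t s] unfolding loc_rel_iff by metis
qed

lemma self_mem_frac: "x \<in> carrier M \<Longrightarrow> s \<in> S \<Longrightarrow> (x, s) \<in> loc_frac R M S x s"
  by (simp add: mem_frac_iff)

lemma carrier_loc_module: "carrier (loc_module R M S) = (\<Union>x\<in>carrier M. \<Union>s\<in>S. {loc_frac R M S x s})"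
  by (auto simp: loc_module_def quotient_def loc_frac_def)

lemma frac_closed: "x \<in> carrier M \<Longrightarrow> s \<in> S \<Longrightarrow> loc_frac R M S x s \<in> carrier (loc_module R M S)"
  by (auto simp: carrier_loc_module)

lemma loc_cases:
  assumes "X \<in> carrier (loc_module R M S)"
  obtains x s where "x \<in> carrier M" "s \<in> S" "X = loc_frac R M S x s"
  using assms by (auto simp: carrier_loc_module)

lemma loc_add:
  assumes c: "x \<in> carrier M" "y \<in> carrier M" "s \<in> S" "t \<in> S"
  shows "loc_frac R M S x s \<oplus>\<^bsub>loc_module R M S\<^esub> loc_frac R M S y t = loc_frac R M S (t \<odot>\<^bsub>M\<^esub> x \<oplus>\<^bsub>M\<^esub> s \<odot>\<^bsub>M\<^esub> y) (s \<otimes>\<^bsub>R\<^esub> t)"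
proof -
  have "loc_frac R M S (t' \<odot>\<^bsub>M\<^esub> x' \<oplus>\<^bsub>M\<^esub> s' \<odot>\<^bsub>M\<^esub> y') (s' \<otimes>\<^bsub>R\<^esub> t') = loc_frac R M S (t \<odot>\<^bsub>M\<^esub> x \<oplus>\<^bsub>M\<^esub> s \<odot>\<^bsub>M\<^esub> y) (s \<otimes>\<^bsub>R\<^esub> t)"
    if "(x', s') \<in> loc_frac R M S x s" "(y', t') \<in> loc_frac R M S y t" for x' s' y' t'
  proof -
    from that c obtain u v where
      d: "x' \<in> carrier M" "y' \<in> carrier M" "s' \<in> S" "t' \<in> S" "u \<in> S" "v \<in> S"
      and 1: "u \<odot>\<^bsub>M\<^esub> (s \<odot>\<^bsub>M\<^esub> x') = u \<odot>\<^bsub>M\<^esub> (s' \<odot>\<^bsub>M\<^esub> x)"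
      and 2: "v \<odot>\<^bsub>M\<^esub> (t \<odot>\<^bsub>M\<^esub> y') = v \<odot>\<^bsub>M\<^esub> (t' \<odot>\<^bsub>M\<^esub> y)"
      by (auto simp: mem_frac_iff frac_eq_iff)
    have "(u \<otimes>\<^bsub>R\<^esub> v) \<odot>\<^bsub>M\<^esub> ((s \<otimes>\<^bsub>R\<^esub> t) \<odot>\<^bsub>M\<^esub> (t' \<odot>\<^bsub>M\<^esub> x' \<oplus>\<^bsub>M\<^esub> s' \<odot>\<^bsub>M\<^esub> y'))
      = (v \<otimes>\<^bsub>R\<^esub> t \<otimes>\<^bsub>R\<^esub> t') \<odot>\<^bsub>M\<^esub> (u \<odot>\<^bsub>M\<^esub> (s \<odot>\<^bsub>M\<^esub> x')) \<oplus>\<^bsub>M\<^esub> (u \<otimes>\<^bsub>R\<^esub> s \<otimes>\<^bsub>R\<^esub> s') \<odot>\<^bsub>M\<^esub> (v \<odot>\<^bsub>M\<^esub> (t \<odot>\<^bsub>M\<^esub> y'))"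
      using c d by (simp add: smult_r_distr smult_assoc1[symmetric] R.m_ac)
    also have "\<dots> = (u \<otimes>\<^bsub>R\<^esub> v) \<odot>\<^bsub>M\<^esub> ((s' \<otimes>\<^bsub>R\<^esub> t') \<odot>\<^bsub>M\<^esub> (t \<odot>\<^bsub>M\<^esub> x \<oplus>\<^bsub>M\<^esub> s \<odot>\<^bsub>M\<^esub> y))"
      unfolding 1 2 using c d by (simp add: smult_r_distr smult_assoc1[symmetric] R.m_ac)
    finally show ?thesis using c d by (subst frac_eq_iff) (auto intro!: bexI[of _ "u \<otimes>\<^bsub>R\<^esub> v"])
  qed
  from UN_const2[OF self_mem_frac self_mem_frac this]
  show ?thesis using c by (simp add: loc_module_def)
qed

end

locale cring_loc = R?: cring R for R :: "('r,'c) ring_scheme" (structure) +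
  fixes S :: "'r set"
  assumes S_sub: "S \<subseteq> carrier R" and S_one: "\<one> \<in> S"
    and S_mult: "\<And>s t. s \<in> S \<Longrightarrow> t \<in> S \<Longrightarrow> s \<otimes> t \<in> S"

sublocale cring_loc \<subseteq> reg: mod_loc R "regular_module R" S
  using module_regular_module S_sub S_one S_mult
  by (auto simp: mod_loc_def mod_loc_axioms_def)

context cring_loc
begin

lemma loc_ring_simps:
  "carrier (loc_ring R S) = carrier (loc_module R (regular_module R) S)"
  "add (loc_ring R S) = add (loc_module R (regular_module R) S)"
  "ring.zero (loc_ring R S) = ring.zero (loc_module R (regular_module R) S)"
  "monoid.mult (loc_ring R S) = smult (loc_module R (regular_module R) S)"
  by (simp_all add: loc_ring_def loc_module_def)

end

sublocale mod_loc \<subseteq> cring_loc R S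
  using S_sub S_one S_mult by unfold_locales auto

context mod_loc
begin

lemma loc_smult:
  assumes c: "a \<in> carrier R" "y \<in> carrier M" "s \<in> S" "t \<in> S"
  shows "loc_frac R (regular_module R) S a s \<odot>\<^bsub>loc_module R M S\<^esub> loc_frac R M S y t = loc_frac R M S (a \<odot>\<^bsub>M\<^esub> y) (s \<otimes>\<^bsub>R\<^esub> t)"
proof -
  have "loc_frac R M S (a' \<odot>\<^bsub>M\<^esub> y') (s' \<otimes>\<^bsub>R\<^esub> t') = loc_frac R M S (a \<odot>\<^bsub>M\<^esub> y) (s \<otimes>\<^bsub>R\<^esub> t)"
    if "(a', s') \<in> loc_frac R (regular_module R) S a s" "(y', t') \<in> loc_frac R M S y t" for a' s' y' t'
  proof -
    from that c obtain u v where
      d: "a' \<in> carrier R" "y' \<in> carrier M" "s' \<in> S" "t' \<in> S" "u \<in> S" "v \<in> S"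
      and 1: "u \<otimes>\<^bsub>R\<^esub> (s \<otimes>\<^bsub>R\<^esub> a') = u \<otimes>\<^bsub>R\<^esub> (s' \<otimes>\<^bsub>R\<^esub> a)"
      and 2: "v \<odot>\<^bsub>M\<^esub> (t \<odot>\<^bsub>M\<^esub> y') = v \<odot>\<^bsub>M\<^esub> (t' \<odot>\<^bsub>M\<^esub> y)"
      by (auto simp: mem_frac_iff frac_eq_iff reg.mem_frac_iff reg.frac_eq_iff)
    have "(u \<otimes>\<^bsub>R\<^esub> v) \<odot>\<^bsub>M\<^esub> ((s \<otimes>\<^bsub>R\<^esub> t) \<odot>\<^bsub>M\<^esub> (a' \<odot>\<^bsub>M\<^esub> y'))
      = (u \<otimes>\<^bsub>R\<^esub> (s \<otimes>\<^bsub>R\<^esub> a')) \<odot>\<^bsub>M\<^esub> (v \<odot>\<^bsub>M\<^esub> (t \<odot>\<^bsub>M\<^esub> y'))"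
      using c d by (simp add: smult_r_distr smult_assoc1[symmetric] R.m_ac)
    also have "\<dots> = (u \<otimes>\<^bsub>R\<^esub> v) \<odot>\<^bsub>M\<^esub> ((s' \<otimes>\<^bsub>R\<^esub> t') \<odot>\<^bsub>M\<^esub> (a \<odot>\<^bsub>M\<^esub> y))"
      unfolding 1 2 using c d by (simp add: smult_r_distr smult_assoc1[symmetric] R.m_ac)
    finally show ?thesis using c d by (subst frac_eq_iff) (auto intro!: bexI[of _ "u \<otimes>\<^bsub>R\<^esub> v"])
  qed
  from UN_const2[OF reg.self_mem_frac self_mem_frac this]
  show ?thesis using c by (simp add: loc_module_def)
qed

end

context cring_loc
begin

lemma loc_mult:
  assumes c: "a \<in> carrier R" "b \<in> carrier R" "s \<in> S" "t \<in> S"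
  shows "loc_frac R (regular_module R) S a s \<otimes>\<^bsub>loc_ring R S\<^esub> loc_frac R (regular_module R) S b t
    = loc_frac R (regular_module R) S (a \<otimes>\<^bsub>R\<^esub> b) (s \<otimes>\<^bsub>R\<^esub> t)"
  using reg.loc_smult[of a b s t] c by (simp add: loc_ring_simps)

end

context mod_loc
begin

lemma loc_zero: "ring.zero (loc_module R M S) = loc_frac R M S \<zero>\<^bsub>M\<^esub> \<one>\<^bsub>R\<^esub>"
  by (simp add: loc_module_def)

lemma abelian_group_loc_module: "abelian_group (loc_module R M S)"
proof (rule abelian_groupI)
  let ?L = "loc_module R M S"
  show "\<zero>\<^bsub>?L\<^esub> \<in> carrier ?L" by (simp add: loc_zero frac_closed)
  fix X assume "X \<in> carrier ?L"
  then obtain x s where X: "x \<in> carrier M" "s \<in> S" "X = loc_frac R M S x s" by (rule loc_cases)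
  show "\<zero>\<^bsub>?L\<^esub> \<oplus>\<^bsub>?L\<^esub> X = X"
    using X by (simp add: loc_zero loc_add)
  show "\<exists>Y\<in>carrier ?L. Y \<oplus>\<^bsub>?L\<^esub> X = \<zero>\<^bsub>?L\<^esub>"
  proof
    show "loc_frac R M S (\<ominus>\<^bsub>M\<^esub> x) s \<in> carrier ?L" using X by (simp add: frac_closed)
    show "loc_frac R M S (\<ominus>\<^bsub>M\<^esub> x) s \<oplus>\<^bsub>?L\<^esub> X = \<zero>\<^bsub>?L\<^esub>"
      using X by (simp add: loc_zero loc_add smult_r_minus M.l_neg) (rule frac_eqI, auto)
  qed
  fix Y assume "Y \<in> carrier ?L"
  then obtain y t where Y: "y \<in> carrier M" "t \<in> S" "Y = loc_frac R M S y t" by (rule loc_cases)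
  show "X \<oplus>\<^bsub>?L\<^esub> Y \<in> carrier ?L" using X Y by (simp add: loc_add frac_closed)
  show "X \<oplus>\<^bsub>?L\<^esub> Y = Y \<oplus>\<^bsub>?L\<^esub> X" using X Y by (simp add: loc_add M.a_comm R.m_comm)
  fix Z assume "Z \<in> carrier ?L"
  then obtain z r where Z: "z \<in> carrier M" "r \<in> S" "Z = loc_frac R M S z r" by (rule loc_cases)
  show "X \<oplus>\<^bsub>?L\<^esub> Y \<oplus>\<^bsub>?L\<^esub> Z = X \<oplus>\<^bsub>?L\<^esub> (Y \<oplus>\<^bsub>?L\<^esub> Z)"
    using X Y Z by (simp add: loc_add smult_r_distr smult_assoc1[symmetric] R.m_ac M.a_ac)
qed

end

context cring_loc
begin

lemma cring_loc_ring: "cring (loc_ring R S)"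
proof (rule cringI)
  let ?L = "loc_ring R S"
  note frac_cases = reg.loc_cases[folded loc_ring_simps]
  note frac_closed = reg.frac_closed[folded loc_ring_simps]
  note loc_add = reg.loc_add[folded loc_ring_simps]
  show "abelian_group ?L"
  proof -
    interpret L: abelian_group "loc_module R (regular_module R) S"
      by (rule reg.abelian_group_loc_module)
    show ?thesis
      by (rule abelian_groupI) (auto simp: loc_ring_simps L.a_ac intro: L.l_neg)
  qed
  have one: "\<one>\<^bsub>?L\<^esub> = loc_frac R (regular_module R) S \<one> \<one>" by (simp add: loc_ring_def)
  show "comm_monoid ?L"
  proof (rule comm_monoidI)
    show "\<one>\<^bsub>?L\<^esub> \<in> carrier ?L" by (simp add: one frac_closed)
    fix X assume "X \<in> carrier ?L"
    then obtain x s where X: "x \<in> carrier R" "s \<in> S" "X = loc_frac R (regular_module R) S x s"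
      by (auto elim: frac_cases)
    show "\<one>\<^bsub>?L\<^esub> \<otimes>\<^bsub>?L\<^esub> X = X" using X by (simp add: one loc_mult)
    fix Y assume "Y \<in> carrier ?L"
    then obtain y t where Y: "y \<in> carrier R" "t \<in> S" "Y = loc_frac R (regular_module R) S y t"
      by (auto elim: frac_cases)
    show "X \<otimes>\<^bsub>?L\<^esub> Y \<in> carrier ?L" using X Y by (simp add: loc_mult frac_closed)
    show "X \<otimes>\<^bsub>?L\<^esub> Y = Y \<otimes>\<^bsub>?L\<^esub> X" using X Y by (simp add: loc_mult R.m_comm)
    fix Z assume "Z \<in> carrier ?L"
    then obtain z r where Z: "z \<in> carrier R" "r \<in> S" "Z = loc_frac R (regular_module R) S z r"
      by (auto elim: frac_cases)
    show "X \<otimes>\<^bsub>?L\<^esub> Y \<otimes>\<^bsub>?L\<^esub> Z = X \<otimes>\<^bsub>?L\<^esub> (Y \<otimes>\<^bsub>?L\<^esub> Z)" using X Y Z by (simp add: loc_mult R.m_ac)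
  qed
  fix X Y Z assume "X \<in> carrier ?L" "Y \<in> carrier ?L" "Z \<in> carrier ?L"
  then obtain x s y t z r where c: "x \<in> carrier R" "s \<in> S" "X = loc_frac R (regular_module R) S x s"
    "y \<in> carrier R" "t \<in> S" "Y = loc_frac R (regular_module R) S y t"
    "z \<in> carrier R" "r \<in> S" "Z = loc_frac R (regular_module R) S z r"
    by (auto elim!: frac_cases)
  then show "(X \<oplus>\<^bsub>?L\<^esub> Y) \<otimes>\<^bsub>?L\<^esub> Z = X \<otimes>\<^bsub>?L\<^esub> Z \<oplus>\<^bsub>?L\<^esub> Y \<otimes>\<^bsub>?L\<^esub> Z"
    using loc_add[of x y s t]
    apply (simp add: loc_mult loc_add[simplified])
    apply (rule reg.frac_eqI)
    by (auto simp: R.r_distr R.l_distr R.m_ac)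
qed

end

context mod_loc
begin

lemma module_loc_module: "module (loc_ring R S) (loc_module R M S)"
proof (rule moduleI)
  let ?A = "loc_ring R S" let ?L = "loc_module R M S"
  note acases = reg.loc_cases[folded loc_ring_simps]
  note add = reg.loc_add[folded loc_ring_simps, simplified]
  show "cring ?A" by (rule cring_loc_ring)
  show "abelian_group ?L" by (rule abelian_group_loc_module)
  fix Y assume "Y \<in> carrier ?L"
  then obtain y t where Y: "y \<in> carrier M" "t \<in> S" "Y = loc_frac R M S y t" by (rule loc_cases)
  show "\<one>\<^bsub>?A\<^esub> \<odot>\<^bsub>?L\<^esub> Y = Y" using Y by (simp add: loc_ring_def loc_smult)
  fix A assume "A \<in> carrier ?A"
  then obtain a s where A: "a \<in> carrier R" "s \<in> S" "A = loc_frac R (regular_module R) S a s"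
    by (auto elim: acases)
  show "A \<odot>\<^bsub>?L\<^esub> Y \<in> carrier ?L" using A Y by (simp add: loc_smult frac_closed)
  { fix Z assume "Z \<in> carrier ?L"
    then obtain z r where Z: "z \<in> carrier M" "r \<in> S" "Z = loc_frac R M S z r" by (rule loc_cases)
    show "A \<odot>\<^bsub>?L\<^esub> (Y \<oplus>\<^bsub>?L\<^esub> Z) = A \<odot>\<^bsub>?L\<^esub> Y \<oplus>\<^bsub>?L\<^esub> A \<odot>\<^bsub>?L\<^esub> Z"
      using A Y Z
      apply (simp add: loc_smult loc_add)
      apply (rule frac_eqI)
      by (auto simp: smult_r_distr smult_assoc1[symmetric] R.m_ac) }
  fix B assume "B \<in> carrier ?A"
  then obtain b r where B: "b \<in> carrier R" "r \<in> S" "B = loc_frac R (regular_module R) S b r"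
    by (auto elim: acases)
  show "(A \<oplus>\<^bsub>?A\<^esub> B) \<odot>\<^bsub>?L\<^esub> Y = A \<odot>\<^bsub>?L\<^esub> Y \<oplus>\<^bsub>?L\<^esub> B \<odot>\<^bsub>?L\<^esub> Y"
    using A B Y
    apply (simp add: loc_smult loc_add add)
    apply (rule frac_eqI)
    by (auto simp: smult_r_distr smult_l_distr smult_assoc1[symmetric] R.m_ac R.r_distr R.l_distr)
  show "(A \<otimes>\<^bsub>?A\<^esub> B) \<odot>\<^bsub>?L\<^esub> Y = A \<odot>\<^bsub>?L\<^esub> (B \<odot>\<^bsub>?L\<^esub> Y)"
    using A B Y by (simp add: loc_smult loc_mult smult_assoc1 R.m_assoc)
qed

lemma loc_map_frac:
  assumes N: "module R N" and v: "v \<in> linear_maps R M N" and c: "x \<in> carrier M" "s \<in> S"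
  shows "loc_map R N S v (loc_frac R M S x s) = loc_frac R N S (v x) s"
proof -
  interpret N: mod_loc R N S
    using N S_sub S_one S_mult by (simp add: mod_loc_def mod_loc_axioms_def)
  have *: "loc_frac R N S (v y) t = loc_frac R N S (v x) s" if "(y, t) \<in> loc_frac R M S x s" for y t
  proof -
    from that c obtain u where d: "y \<in> carrier M" "t \<in> S" "u \<in> S"
      and 1: "u \<odot>\<^bsub>M\<^esub> (s \<odot>\<^bsub>M\<^esub> y) = u \<odot>\<^bsub>M\<^esub> (t \<odot>\<^bsub>M\<^esub> x)"
      by (auto simp: mem_frac_iff frac_eq_iff)
    then have "u \<odot>\<^bsub>N\<^esub> (s \<odot>\<^bsub>N\<^esub> v y) = u \<odot>\<^bsub>N\<^esub> (t \<odot>\<^bsub>N\<^esub> v x)"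
      using c linear_mapsD[OF v] by (metis S_carrier smult_closed)
    then show ?thesis using c d linear_mapsD[OF v] by (subst N.frac_eq_iff) auto
  qed
  show ?thesis unfolding loc_map_def
  proof (rule SUP_eq_const)
    show "loc_frac R M S x s \<noteq> {}" using self_mem_frac[of x s] c by blast
    fix p assume "p \<in> loc_frac R M S x s"
    then show "(case p of (y, t) \<Rightarrow> loc_frac R N S (v y) t) = loc_frac R N S (v x) s"
      using *[of "fst p" "snd p"] by (simp only: prod.case_eq_if prod.collapse)
  qed
qed

lemma loc_map_linear:
  assumes N: "module R N" and v: "v \<in> linear_maps R M N"
  shows "loc_map R N S v \<in> linear_maps (loc_ring R S) (loc_module R M S) (loc_module R N S)"
proof -
  interpret N: mod_loc R N S
    using N S_sub S_one S_mult by (simp add: mod_loc_def mod_loc_axioms_def)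
  note acases = reg.loc_cases[folded loc_ring_simps]
  note lin = linear_mapsD[OF v] and frac = loc_map_frac[OF N v]
  show ?thesis unfolding linear_maps_def
  proof (intro CollectI conjI ballI funcsetI)
    fix V assume "V \<in> carrier (loc_module R M S)"
    then obtain x s where V: "x \<in> carrier M" "s \<in> S" "V = loc_frac R M S x s" by (rule loc_cases)
    show "loc_map R N S v V \<in> carrier (loc_module R N S)"
      using V lin(1) by (simp add: frac N.frac_closed)
    { fix W assume "W \<in> carrier (loc_module R M S)"
      then obtain y t where W: "y \<in> carrier M" "t \<in> S" "W = loc_frac R M S y t" by (rule loc_cases)
      show "loc_map R N S v (V \<oplus>\<^bsub>loc_module R M S\<^esub> W)
        = loc_map R N S v V \<oplus>\<^bsub>loc_module R N S\<^esub> loc_map R N S v W"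
        using V W by (simp add: frac lin loc_add N.loc_add) }
    fix A assume "A \<in> carrier (loc_ring R S)"
    then obtain a t where A: "a \<in> carrier R" "t \<in> S" "A = loc_frac R (regular_module R) S a t"
      by (auto elim: acases)
    show "loc_map R N S v (A \<odot>\<^bsub>loc_module R M S\<^esub> V) = A \<odot>\<^bsub>loc_module R N S\<^esub> loc_map R N S v V"
      using V A by (simp add: frac lin loc_smult N.loc_smult)
  qed
qed

end

lemma (in primeideal) cring_loc_complement: "cring_loc R (carrier R - I)"
proof -
  have "\<one> \<notin> I" using I_notcarr one_imp_carrier by blast
  then show ?thesis
    using I_prime by unfold_locales auto
qed


section \<open>The spectrum and pure loci\<close>

definition Spec :: "('r, 'c) ring_scheme \<Rightarrow> 'r set set"
  where "Spec R = {p. primeideal p R}"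

definition zariski :: "('r, 'c) ring_scheme \<Rightarrow> 'r set topology"
  where "zariski R = topology (\<lambda>U. \<exists>A \<subseteq> carrier R. U = {p \<in> Spec R. \<not> A \<subseteq> p})"

lemma openin_zariski:
  assumes "cring R"
  shows "openin (zariski R) U \<longleftrightarrow> (\<exists>A \<subseteq> carrier R. U = {p \<in> Spec R. \<not> A \<subseteq> p})"
proof -
  interpret cring R by fact
  let ?D = "\<lambda>A. {p \<in> Spec R. \<not> A \<subseteq> p}"
  have "istopology (\<lambda>U. \<exists>A \<subseteq> carrier R. U = ?D A)"
    unfolding istopology_def
  proof (intro conjI allI impI)
    fix U V assume "\<exists>A\<subseteq>carrier R. U = ?D A" "\<exists>A\<subseteq>carrier R. V = ?D A"
    then obtain A B where AB: "A \<subseteq> carrier R" "B \<subseteq> carrier R" "U = ?D A" "V = ?D B" by blast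
    have "p \<in> ?D A \<and> p \<in> ?D B \<longleftrightarrow> p \<in> ?D {a \<otimes>\<^bsub>R\<^esub> b | a b. a \<in> A \<and> b \<in> B}" for p
    proof (cases "p \<in> Spec R")
      case True
      then interpret primeideal p R by (simp add: Spec_def)
      have "a \<otimes>\<^bsub>R\<^esub> b \<in> p \<longleftrightarrow> a \<in> p \<or> b \<in> p" if "a \<in> A" "b \<in> B" for a b
        using that AB I_prime[of a b] I_r_closed[of a b] I_l_closed[of b a] by auto
      then have "{a \<otimes>\<^bsub>R\<^esub> b | a b. a \<in> A \<and> b \<in> B} \<subseteq> p \<longleftrightarrow> A \<subseteq> p \<or> B \<subseteq> p"
        by blast
      then show ?thesis using True by blast
    qed simp
    then have "U \<inter> V = ?D {a \<otimes>\<^bsub>R\<^esub> b | a b. a \<in> A \<and> b \<in> B}" using AB by blast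
    moreover have "{a \<otimes>\<^bsub>R\<^esub> b | a b. a \<in> A \<and> b \<in> B} \<subseteq> carrier R" using AB by auto
    ultimately show "\<exists>A\<subseteq>carrier R. U \<inter> V = ?D A" by blast
  next
    fix \<K> assume "\<forall>K\<in>\<K>. \<exists>A\<subseteq>carrier R. K = ?D A"
    then obtain A where A: "\<And>K. K \<in> \<K> \<Longrightarrow> A K \<subseteq> carrier R \<and> K = ?D (A K)" by metis
    have "(\<Union>K\<in>\<K>. K) = (\<Union>K\<in>\<K>. ?D (A K))"
      by (rule SUP_cong[OF refl]) (rule A[THEN conjunct2])
    then have "\<Union>\<K> = (\<Union>K\<in>\<K>. ?D (A K))" by simp
    also have "\<dots> = ?D (\<Union>K\<in>\<K>. A K)" by blast
    finally have "\<Union>\<K> = ?D (\<Union>K\<in>\<K>. A K)" .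
    moreover have "(\<Union>K\<in>\<K>. A K) \<subseteq> carrier R"
      by (rule UN_least) (rule A[THEN conjunct1])
    ultimately show "\<exists>A\<subseteq>carrier R. \<Union>\<K> = ?D A" by (intro exI conjI)
  qed
  then show ?thesis by (simp add: zariski_def topology_inverse')
qed

definition pure_locus ::
  "('r, 'c) ring_scheme \<Rightarrow> ('r, 'm, 'd) module_scheme \<Rightarrow> ('r, 'n, 'e) module_scheme \<Rightarrow>
   ('m \<Rightarrow> 'n) \<Rightarrow> 'r set set"
  where "pure_locus R M N v =
    {p \<in> Spec R.
       pure_map (loc_ring R (carrier R - p))
         (loc_module R M (carrier R - p)) (loc_module R N (carrier R - p))
         (loc_map R N (carrier R - p) v)}"

definition pure_loci_open :: "('r, 'c) ring_scheme \<Rightarrow> ('r, 'm, 'd) module_scheme \<Rightarrow> bool"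
  where "pure_loci_open R M \<longleftrightarrow>
    (\<forall>v \<in> linear_maps R (regular_module R) M.
       openin (zariski R) (pure_locus R (regular_module R) M v))"

definition has_least_radical_ideals :: "('r, 'c) ring_scheme \<Rightarrow> ('r, 'm, 'd) module_scheme \<Rightarrow> bool"
  where "has_least_radical_ideals R M \<longleftrightarrow>
    (\<forall>x \<in> carrier M.
       \<exists>J \<in> {I. radical_ideal I R \<and> x \<in> ideal_smult M I}.
         \<forall>I \<in> {I. radical_ideal I R \<and> x \<in> ideal_smult M I}. J \<subseteq> I)"

text \<open>
  Intersecting with the carriers only matters for the empty family, whose intersection is the
  whole ring (respectively module).
\<close>

definition radical_Inter_distrib :: "('r, 'c) ring_scheme \<Rightarrow> ('r, 'm, 'd) module_scheme \<Rightarrow> bool"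
  where "radical_Inter_distrib R M \<longleftrightarrow>
    (\<forall>\<I>. (\<forall>I\<in>\<I>. radical_ideal I R) \<longrightarrow>
       carrier M \<inter> (\<Inter>I\<in>\<I>. ideal_smult M I) = ideal_smult M (carrier R \<inter> \<Inter>\<I>))"

end

theory Submission
  imports Defs "HOL-Algebra.QuotRing" "HOL-Algebra.Ring_Divisibility"
begin

text \<open>
  The key point is that, for \<open>M\<close> flat and \<open>v : R \<rightarrow> M\<close> with \<open>v(1) = x\<close>, the pure locus of \<open>v\<close> is the set of
  primes \<open>p\<close> with \<open>x \<notin> p M\<close> (lemma \<open>pure_locus_regular_eq\<close>).  If \<open>x \<in> p M\<close>, then \<open>v\<^sub>p\<close> becomes zero after
  tensoring with the residue field at \<open>p\<close>.  Conversely, every element of \<open>R\<^sub>p \<otimes> P\<close> is a pure tensor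
  \<open>1 \<otimes> q\<close>, and its image in \<open>M\<^sub>p \<otimes> P = M \<otimes> P\<close> is \<open>x \<otimes> q\<close>.  If this vanishes, flatness allows it
  to be tested in \<open>M \<otimes> R q = M / (Ann q) M\<close>, so \<open>x \<in> (Ann q) M\<close>.  As \<open>P\<close> is a module over the local ring
  \<open>R\<^sub>p\<close>, the annihilator of a nonzero \<open>q\<close> lies in \<open>p\<close>, whence \<open>x \<in> p M\<close>.

  Openness of the pure loci thus means that for every \<open>x\<close> the set of primes \<open>p\<close> with \<open>x \<in> p M\<close> is
  closed.  A least radical ideal \<open>J\<close> with \<open>x \<in> J M\<close> defines that closed set.  In the other direction,
  let \<open>J\<close> be the intersection of the primes in the closed set; as every radical ideal is an
  intersection of primes, only \<open>x \<in> J M\<close> is in question, and this can be checked locally.  Every prime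
  \<open>q \<supseteq> J\<close> belongs to the closed set, so the content of \<open>x\<close> in \<open>M\<^sub>p\<close> lies in \<open>q R\<^sub>p\<close> for all such
  \<open>q \<subseteq> p\<close>, that is, in \<open>J R\<^sub>p\<close>.  If \<open>M\<^sub>p\<close> is Ohm-Rush, then \<open>x\<close> lies in the product of its content
  with \<open>M\<^sub>p\<close>, hence in \<open>J M\<^sub>p\<close>.
\<close>

section \<open>Prime ideals avoiding a multiplicative set\<close>

text \<open>An ideal that is maximal among those avoiding a multiplicative set is prime.\<close>

lemma (in cring) exists_prime_avoiding:
  assumes I: "ideal I R"
    and T: "T \<subseteq> carrier R" "\<one> \<in> T" "\<And>s t. s \<in> T \<Longrightarrow> t \<in> T \<Longrightarrow> s \<otimes> t \<in> T"
    and disj: "I \<inter> T = {}"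
  obtains q where "primeideal q R" "I \<subseteq> q" "q \<inter> T = {}"
proof -
  let ?A = "{J. ideal J R \<and> I \<subseteq> J \<and> J \<inter> T = {}}"
  have "\<exists>m\<in>?A. \<forall>X\<in>?A. m \<subseteq> X \<longrightarrow> X = m"
  proof (rule subset_Zorn_nonempty)
    show "?A \<noteq> {}" using I disj by blast
    fix C assume C: "C \<noteq> {}" "subset.chain ?A C"
    then have sub: "C \<subseteq> ?A" by (auto simp: pred_on.chain_def)
    then have "subset.chain {J. ideal J R} C"
      using C(2) by (auto simp: pred_on.chain_def)
    then have "ideal (\<Union>C) R" using chain_Union_is_ideal[of C] C(1) by simp
    then show "\<Union>C \<in> ?A" using sub C(1) by blast
  qed
  then obtain m where m: "ideal m R" "I \<subseteq> m" "m \<inter> T = {}"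
    and max: "\<And>X. ideal X R \<Longrightarrow> m \<subseteq> X \<Longrightarrow> X \<inter> T = {} \<Longrightarrow> X = m"
    by (smt (verit) mem_Collect_eq order_trans)
  interpret m: ideal m R by fact
  \<comment> \<open>By maximality, adjoining an outside element makes the ideal meet the multiplicative set.\<close>
  have meet: "\<exists>y\<in>m. \<exists>r\<in>carrier R. y \<oplus> r \<otimes> a \<in> T" if a: "a \<in> carrier R" "a \<notin> m" for a
  proof -
    let ?X = "m <+>\<^bsub>R\<^esub> PIdl a"
    have X: "ideal ?X R" using add_ideals[OF m(1) cgenideal_ideal[OF a(1)]] .
    have sub: "m \<union> PIdl a \<subseteq> ?X"
      using union_genideal[OF m(1) cgenideal_ideal[OF a(1)]]
        genideal_self[of "m \<union> PIdl a"] m.a_subset a(1) by (auto simp: cgenideal_def)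
    then have "?X \<noteq> m" using cgenideal_self[OF a(1)] a(2) by blast
    then have "?X \<inter> T \<noteq> {}" using max[OF X] sub by blast
    then show ?thesis by (auto simp: set_add_def' cgenideal_def)
  qed
  have "primeideal m R"
  proof (rule primeidealI)
    show "carrier R \<noteq> m" using T m(3) by auto
    fix a b assume ab: "a \<in> carrier R" "b \<in> carrier R" "a \<otimes> b \<in> m"
    show "a \<in> m \<or> b \<in> m"
    proof (rule ccontr)
      assume "\<not> (a \<in> m \<or> b \<in> m)"
      then obtain y r z s where
        y: "y \<in> m" "r \<in> carrier R" "y \<oplus> r \<otimes> a \<in> T" and
        z: "z \<in> m" "s \<in> carrier R" "z \<oplus> s \<otimes> b \<in> T"
        using meet[OF ab(1)] meet[OF ab(2)] by blast
      have c: "y \<in> carrier R" "z \<in> carrier R" using y z m.a_subset by auto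
      have "(y \<oplus> r \<otimes> a) \<otimes> (z \<oplus> s \<otimes> b)
          = y \<otimes> (z \<oplus> s \<otimes> b) \<oplus> ((r \<otimes> a) \<otimes> z \<oplus> (r \<otimes> s) \<otimes> (a \<otimes> b))"
        using c y(2) z(2) ab by (simp add: l_distr r_distr m_ac a_ac)
      also have "\<dots> \<in> m"
        using c y(1,2) z ab(1,2) T(1) m.I_r_closed[OF y(1)] m.I_l_closed[OF z(1)] m.I_l_closed[OF ab(3)]
        by (meson m.a_closed m_closed subsetD)
      finally show False using T(3)[OF y(3) z(3)] m(3) by blast
    qed
  qed (use m is_cring in auto)
  then show thesis using that m by blast
qed

lemma radical_idealD:
  assumes "radical_ideal I R"
  shows "ideal I R" "a \<in> carrier R \<Longrightarrow> a [^]\<^bsub>R\<^esub> (n::nat) \<in> I \<Longrightarrow> a \<in> I"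
  using assms unfolding radical_ideal_def ideal_radical_def by blast+

lemma radical_idealI:
  assumes "ideal I R" "\<And>a n. a \<in> carrier R \<Longrightarrow> a [^]\<^bsub>R\<^esub> (n::nat) \<in> I \<Longrightarrow> a \<in> I"
  shows "radical_ideal I R"
proof -
  interpret ideal I R by fact
  have "a [^]\<^bsub>R\<^esub> (1::nat) \<in> I" if "a \<in> I" for a using that a_subset by auto
  then show ?thesis
    unfolding radical_ideal_def ideal_radical_def using assms a_subset by blast
qed

lemma (in primeideal) prime_pow:
  assumes "a \<in> carrier R" "a [^] (n::nat) \<in> I"
  shows "a \<in> I"
  using assms(2)
proof (induction n)
  case 0
  then show ?case using I_notcarr one_imp_carrier by simp
next
  case (Suc n)
  then show ?case using I_prime[of "a [^] n" a] assms(1) by auto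
qed

lemma (in primeideal) radical_ideal: "radical_ideal I R"
  using radical_idealI[OF is_ideal] prime_pow by blast

lemma (in cring) radical_ideal_Inter:
  assumes "\<And>I. I \<in> \<I> \<Longrightarrow> radical_ideal I R"
  shows "radical_ideal (carrier R \<inter> \<Inter>\<I>) R"
proof (rule radical_idealI)
  have "ideal (\<Inter>(insert (carrier R) \<I>)) R"
    by (rule i_Intersect) (use assms radical_idealD(1) oneideal in auto)
  then show "ideal (carrier R \<inter> \<Inter>\<I>) R" by simp
next
  fix a and n :: nat assume "a \<in> carrier R" "a [^] n \<in> carrier R \<inter> \<Inter>\<I>"
  then show "a \<in> carrier R \<inter> \<Inter>\<I>"
    by (auto intro: radical_idealD(2)[OF assms, of _ a n])
qed

text \<open>
  A local form of the fact that a radical ideal is an intersection of primes: the primes disjoint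
  from \<open>S\<close> are the primes of the localization at \<open>S\<close>.  It holds because a prime avoiding all
  products \<open>u a\<^sup>n\<close> with \<open>u \<in> S\<close> is disjoint from \<open>S\<close> and does not contain \<open>a\<close>.
\<close>

lemma (in cring_loc) mem_radical_ideal_up_to_unit:
  assumes J: "radical_ideal J R" and a: "a \<in> carrier R"
    and primes: "\<And>q. primeideal q R \<Longrightarrow> J \<subseteq> q \<Longrightarrow> q \<inter> S = {} \<Longrightarrow> a \<in> q"
  shows "\<exists>u\<in>S. u \<otimes> a \<in> J"
proof -
  interpret J: ideal J R using radical_idealD(1)[OF J] .
  define T where "T = {u \<otimes> a [^] n | u n::nat. u \<in> S}"
  have S_in: "s \<in> carrier R" if "s \<in> S" for s using that S_sub by auto
  have TI: "u \<otimes> a [^] (n::nat) \<in> T" if "u \<in> S" for u n using that by (auto simp: T_def)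
  have "J \<inter> T \<noteq> {}"
  proof
    assume disj: "J \<inter> T = {}"
    have T1: "T \<subseteq> carrier R" using a S_in by (auto simp: T_def)
    have T2: "\<one> \<in> T" using TI[OF S_one, of 0] by simp
    have T3: "s \<otimes> t \<in> T" if st: "s \<in> T" "t \<in> T" for s t
    proof -
      from st obtain u w and m n :: nat where *: "s = u \<otimes> a [^] m" "t = w \<otimes> a [^] n" "u \<in> S" "w \<in> S"
        unfolding T_def by blast
      then have "s \<otimes> t = (u \<otimes> w) \<otimes> a [^] (m + n)"
        using a S_in by (simp add: R.nat_pow_mult[symmetric] R.m_ac)
      then show ?thesis using TI S_mult * by simp
    qed
    obtain q where q: "primeideal q R" "J \<subseteq> q" "q \<inter> T = {}"
      by (rule R.exists_prime_avoiding[OF J.is_ideal T1 T2 T3 disj])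
    have "S \<subseteq> T"
    proof
      fix s assume "s \<in> S"
      then show "s \<in> T" using TI[of s 0] S_in by simp
    qed
    then have "a \<in> q" using primes q by blast
    moreover have "a \<in> T" using TI[OF S_one, of 1] a by simp
    ultimately show False using q by blast
  qed
  then obtain u and n :: nat where u: "u \<in> S" "u \<otimes> a [^] n \<in> J" by (auto simp: T_def)
  have c: "u \<in> carrier R" using u S_in by simp
  \<comment> \<open>The exponent \<open>n + 1\<close> leaves a factor \<open>a\<close> to spare, which is needed when \<open>n = 0\<close>.\<close>
  have "(u \<otimes> a) [^] Suc n = (u \<otimes> a [^] n) \<otimes> (u [^] n \<otimes> a)"
    using c a by (simp add: R.nat_pow_distrib R.m_ac)
  also have "\<dots> \<in> J" using J.I_r_closed u(2) c a by simp
  finally show ?thesis using radical_idealD(2)[OF J, of "u \<otimes> a"] u(1) c a by blast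
qed

lemma (in cring) radical_ideal_eq_Inter_primes:
  assumes J: "radical_ideal J R" and a: "a \<in> carrier R"
    and primes: "\<And>q. primeideal q R \<Longrightarrow> J \<subseteq> q \<Longrightarrow> a \<in> q"
  shows "a \<in> J"
proof -
  interpret cring_loc R "{\<one>}" by unfold_locales auto
  have "\<exists>u\<in>{\<one>}. u \<otimes> a \<in> J"
    by (rule mem_radical_ideal_up_to_unit[OF J a]) (rule primes)
  then show ?thesis using a by simp
qed


section \<open>The submodule generated by an ideal\<close>

context module
begin

lemma ideal_smult_carrier:
  assumes "I \<subseteq> carrier R"
  shows "ideal_smult M I \<subseteq> carrier M"
proof -
  have "{a \<odot>\<^bsub>M\<^esub> x | a x. a \<in> I \<and> x \<in> carrier M} \<subseteq> carrier (add_monoid M)"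
    using assms by auto
  from group.generate_incl[OF M.a_group this] show ?thesis by (simp add: ideal_smult_def)
qed

lemma ideal_smult_subgroup:
  assumes "I \<subseteq> carrier R"
  shows "subgroup (ideal_smult M I) (add_monoid M)"
  unfolding ideal_smult_def
  by (rule group.generate_is_subgroup[OF M.a_group]) (use assms in auto)

lemma ideal_smult_closed:
  assumes "I \<subseteq> carrier R"
  shows "\<zero>\<^bsub>M\<^esub> \<in> ideal_smult M I"
    "x \<in> ideal_smult M I \<Longrightarrow> y \<in> ideal_smult M I \<Longrightarrow> x \<oplus>\<^bsub>M\<^esub> y \<in> ideal_smult M I"
    "x \<in> ideal_smult M I \<Longrightarrow> \<ominus>\<^bsub>M\<^esub> x \<in> ideal_smult M I"
  using subgroup.one_closed[OF ideal_smult_subgroup[OF assms]]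
    subgroup.m_closed[OF ideal_smult_subgroup[OF assms], of x y]
    subgroup.m_inv_closed[OF ideal_smult_subgroup[OF assms], of x]
  by (auto simp: a_inv_def)

lemma ideal_smult_gen: "a \<in> I \<Longrightarrow> x \<in> carrier M \<Longrightarrow> a \<odot>\<^bsub>M\<^esub> x \<in> ideal_smult M I"
  unfolding ideal_smult_def by (rule generate.incl) blast

lemma ideal_smult_mono: "I \<subseteq> J \<Longrightarrow> ideal_smult M I \<subseteq> ideal_smult M J"
  unfolding ideal_smult_def by (rule group.mono_generate[OF M.a_group]) blast

lemma ideal_smult_induct [consumes 2, case_names zero gen add uminus]:
  assumes I: "I \<subseteq> carrier R" and z: "z \<in> ideal_smult M I"
    and zero: "Q \<zero>\<^bsub>M\<^esub>" and gen: "\<And>a x. a \<in> I \<Longrightarrow> x \<in> carrier M \<Longrightarrow> Q (a \<odot>\<^bsub>M\<^esub> x)"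
    and add: "\<And>x y. x \<in> ideal_smult M I \<Longrightarrow> y \<in> ideal_smult M I \<Longrightarrow> Q x \<Longrightarrow> Q y \<Longrightarrow> Q (x \<oplus>\<^bsub>M\<^esub> y)"
    and uminus: "\<And>x. x \<in> ideal_smult M I \<Longrightarrow> Q x \<Longrightarrow> Q (\<ominus>\<^bsub>M\<^esub> x)"
  shows "Q z"
  using z unfolding ideal_smult_def
proof (induction rule: generate.induct)
  case one
  then show ?case using zero by simp
next
  case (incl h)
  then show ?case using gen by auto
next
  case (inv h)
  then obtain a x where h: "a \<in> I" "x \<in> carrier M" "h = a \<odot>\<^bsub>M\<^esub> x" by blast
  then show ?case using uminus[OF ideal_smult_gen[OF h(1,2)]] gen by (simp add: a_inv_def)
next
  case (eng h k)
  then show ?case using add[of h k] by (simp add: ideal_smult_def)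
qed

lemma ideal_smult_smult_closed:
  assumes "ideal I R" "r \<in> carrier R" "z \<in> ideal_smult M I"
  shows "r \<odot>\<^bsub>M\<^esub> z \<in> ideal_smult M I"
proof -
  interpret I: ideal I R by fact
  note sub = I.a_subset
  have sc: "z \<in> ideal_smult M I \<Longrightarrow> z \<in> carrier M" for z using ideal_smult_carrier[OF sub] by blast
  show ?thesis
    using sub assms(3)
  proof (induction rule: ideal_smult_induct)
    case (gen a x)
    have "r \<odot>\<^bsub>M\<^esub> (a \<odot>\<^bsub>M\<^esub> x) = (r \<otimes>\<^bsub>R\<^esub> a) \<odot>\<^bsub>M\<^esub> x"
      using gen assms(2) sub by (auto simp: smult_assoc1)
    then show ?case using ideal_smult_gen[OF I.I_l_closed[OF gen(1) assms(2)] gen(2)] by simp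
  qed (use assms(2) sc sub in \<open>simp_all add: smult_r_distr smult_r_minus ideal_smult_closed[OF sub]\<close>)
qed

lemma mem_ideal_smult_carrier: "x \<in> carrier M \<Longrightarrow> x \<in> ideal_smult M (carrier R)"
  using ideal_smult_gen[of "\<one>" "carrier R" x] by simp

text \<open>
  Membership in \<open>J M\<close> is a local property: the ideal of all \<open>r\<close> with \<open>r x \<in> J M\<close> is contained in no
  prime, hence is the unit ideal.
\<close>

lemma mem_ideal_smult_local:
  assumes J: "ideal J R" and x: "x \<in> carrier M"
    and loc: "\<And>p. primeideal p R \<Longrightarrow> \<exists>u\<in>carrier R - p. u \<odot>\<^bsub>M\<^esub> x \<in> ideal_smult M J"
  shows "x \<in> ideal_smult M J"
proof (rule ccontr)
  assume not: "x \<notin> ideal_smult M J"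
  interpret J: ideal J R by fact
  note cl = ideal_smult_closed[OF J.a_subset] ideal_smult_smult_closed[OF J]
  let ?K = "{r \<in> carrier R. r \<odot>\<^bsub>M\<^esub> x \<in> ideal_smult M J}"
  have "ideal ?K R"
  proof (rule idealI)
    show "subgroup ?K (add_monoid R)"
    proof (rule group.subgroupI[OF R.a_group])
      show "?K \<noteq> {}" using x cl(1) by (auto intro: exI[of _ "\<zero>"])
      show "inv\<^bsub>add_monoid R\<^esub> a \<in> ?K" if "a \<in> ?K" for a
        using that x cl(3) by (simp add: a_inv_def[symmetric] smult_l_minus)
      show "a \<otimes>\<^bsub>add_monoid R\<^esub> b \<in> ?K" if "a \<in> ?K" "b \<in> ?K" for a b
        using that x cl(2) by (simp add: smult_l_distr)
    qed auto
    show "r \<otimes> a \<in> ?K" if "a \<in> ?K" "r \<in> carrier R" for a r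
      using that x cl(4) by (simp add: smult_assoc1)
    then show "a \<otimes> r \<in> ?K" if "a \<in> ?K" "r \<in> carrier R" for a r
      using that by (simp add: R.m_comm[of a r])
  qed (rule R.ring_axioms)
  then obtain p where p: "primeideal p R" "?K \<subseteq> p"
  proof (rule R.exists_prime_avoiding[of ?K "{\<one>}"])
    show "?K \<inter> {\<one>} = {}" using not x by simp
  qed auto
  then show False using loc[OF p(1)] by blast
qed

end


section \<open>Vanishing of tensors\<close>

lemma tensor_ker_swap:
  assumes M: "module R M" and P: "module R P" and c: "c \<in> tensor_ker R M P"
  shows "frag_push prod.swap c \<in> tensor_ker R P M"
  using M P c
proof (induction rule: tensor_ker_induct)
  case (rel c)
  note cl = tensor_ker_closed[OF P M]
  consider (a) x x' y where "c = frag_of (x \<oplus>\<^bsub>M\<^esub> x', y) - (frag_of (x, y) + frag_of (x', y))"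
      "x \<in> carrier M" "x' \<in> carrier M" "y \<in> carrier P"
    | (b) x y y' where "c = frag_of (x, y \<oplus>\<^bsub>P\<^esub> y') - (frag_of (x, y) + frag_of (x, y'))"
      "x \<in> carrier M" "y \<in> carrier P" "y' \<in> carrier P"
    | (s) a x y where "c = frag_of (a \<odot>\<^bsub>M\<^esub> x, y) - frag_of (x, a \<odot>\<^bsub>P\<^esub> y)"
      "a \<in> carrier R" "x \<in> carrier M" "y \<in> carrier P"
    using rel unfolding tensor_rels_def by blast
  then show ?case
  proof cases
    case a
    then have "frag_push prod.swap c \<in> tensor_rels R P M"
      unfolding tensor_rels_def by (auto simp: frag_extend_diff frag_extend_add)
    then show ?thesis by (rule tensor_ker_rels)
  next
    case b
    then have "frag_push prod.swap c \<in> tensor_rels R P M"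
      unfolding tensor_rels_def by (auto simp: frag_extend_diff frag_extend_add)
    then show ?thesis by (rule tensor_ker_rels)
  next
    case s
    then have "frag_of (a \<odot>\<^bsub>P\<^esub> y, x) - frag_of (y, a \<odot>\<^bsub>M\<^esub> x) \<in> tensor_rels R P M"
      unfolding tensor_rels_def by blast
    from cl(3)[OF tensor_ker_rels[OF this]] show ?thesis
      using s by (simp add: frag_extend_diff)
  qed
qed (auto simp: frag_extend_add frag_extend_minus intro!: tensor_ker_closed M P)

locale tensor_pair = M: module R M + P: module R P
  for R :: "('r, 'c) ring_scheme" (structure) and M :: "('r, 'm, 'd) module_scheme" (structure)
    and P :: "('r, 'p, 'e) module_scheme" (structure)
begin

definition tensor_eq :: "('m \<times> 'p \<Rightarrow>\<^sub>0 int) \<Rightarrow> ('m \<times> 'p \<Rightarrow>\<^sub>0 int) \<Rightarrow> bool" (infix \<open>\<approx>\<^sub>\<otimes>\<close> 50)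
  where "c \<approx>\<^sub>\<otimes> d \<longleftrightarrow> c - d \<in> tensor_ker R M P"

lemmas ker_closed = tensor_ker_closed[OF M.module_axioms P.module_axioms]

lemma eq_sym: "c \<approx>\<^sub>\<otimes> d \<Longrightarrow> d \<approx>\<^sub>\<otimes> c"
  using ker_closed(3)[of "c - d"] by (simp add: tensor_eq_def)

lemma eq_trans [trans]: "c \<approx>\<^sub>\<otimes> d \<Longrightarrow> d \<approx>\<^sub>\<otimes> e \<Longrightarrow> c \<approx>\<^sub>\<otimes> e"
  using ker_closed(2)[of "c - d" "d - e"] by (simp add: tensor_eq_def)

lemma eq_add: "c \<approx>\<^sub>\<otimes> d \<Longrightarrow> c' \<approx>\<^sub>\<otimes> d' \<Longrightarrow> c + c' \<approx>\<^sub>\<otimes> d + d'"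
  using ker_closed(2)[of "c - d" "c' - d'"] by (simp add: tensor_eq_def algebra_simps)

lemma eq_diff: "c \<approx>\<^sub>\<otimes> d \<Longrightarrow> c' \<approx>\<^sub>\<otimes> d' \<Longrightarrow> c - c' \<approx>\<^sub>\<otimes> d - d'"
  using ker_closed(4)[of "c - d" "c' - d'"] by (simp add: tensor_eq_def algebra_simps)

lemma eq_zero_iff: "c \<approx>\<^sub>\<otimes> 0 \<longleftrightarrow> c \<in> tensor_ker R M P"
  by (simp add: tensor_eq_def)

lemma mem_ker_cong: "c \<approx>\<^sub>\<otimes> d \<Longrightarrow> c \<in> tensor_ker R M P \<longleftrightarrow> d \<in> tensor_ker R M P"
  using eq_trans eq_sym eq_zero_iff by blast

lemma tensor_add_left:
  "x \<in> carrier M \<Longrightarrow> x' \<in> carrier M \<Longrightarrow> y \<in> carrier P \<Longrightarrow>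
    frag_of (x \<oplus>\<^bsub>M\<^esub> x', y) \<approx>\<^sub>\<otimes> frag_of (x, y) + frag_of (x', y)"
  unfolding tensor_eq_def by (rule tensor_ker_rels) (unfold tensor_rels_def, blast)

lemma tensor_add_right:
  "x \<in> carrier M \<Longrightarrow> y \<in> carrier P \<Longrightarrow> y' \<in> carrier P \<Longrightarrow>
    frag_of (x, y \<oplus>\<^bsub>P\<^esub> y') \<approx>\<^sub>\<otimes> frag_of (x, y) + frag_of (x, y')"
  unfolding tensor_eq_def by (rule tensor_ker_rels) (unfold tensor_rels_def, blast)

lemma tensor_smult:
  "a \<in> carrier R \<Longrightarrow> x \<in> carrier M \<Longrightarrow> y \<in> carrier P \<Longrightarrow>
    frag_of (a \<odot>\<^bsub>M\<^esub> x, y) \<approx>\<^sub>\<otimes> frag_of (x, a \<odot>\<^bsub>P\<^esub> y)"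
  unfolding tensor_eq_def by (rule tensor_ker_rels) (unfold tensor_rels_def, blast)

lemma tensor_diff_right:
  assumes "x \<in> carrier M" "y \<in> carrier P" "y' \<in> carrier P"
  shows "frag_of (x, y) - frag_of (x, y') \<approx>\<^sub>\<otimes> frag_of (x, y \<ominus>\<^bsub>P\<^esub> y')"
proof -
  have "frag_of (x, (y \<ominus>\<^bsub>P\<^esub> y') \<oplus>\<^bsub>P\<^esub> y') \<approx>\<^sub>\<otimes> frag_of (x, y \<ominus>\<^bsub>P\<^esub> y') + frag_of (x, y')"
    using assms by (intro tensor_add_right) auto
  moreover have "(y \<ominus>\<^bsub>P\<^esub> y') \<oplus>\<^bsub>P\<^esub> y' = y"
    using assms by (simp add: a_minus_def P.M.a_assoc P.M.l_neg)
  ultimately show ?thesis by (simp add: tensor_eq_def algebra_simps)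
qed

lemma tensor_zero_left:
  assumes "y \<in> carrier P" shows "frag_of (\<zero>\<^bsub>M\<^esub>, y) \<in> tensor_ker R M P"
  using tensor_add_left[of "\<zero>\<^bsub>M\<^esub>" "\<zero>\<^bsub>M\<^esub>" y] assms ker_closed(3)[of "- frag_of (\<zero>\<^bsub>M\<^esub>, y)"]
  by (simp add: tensor_eq_def)

lemma tensor_zero_right:
  assumes "x \<in> carrier M" shows "frag_of (x, \<zero>\<^bsub>P\<^esub>) \<in> tensor_ker R M P"
  using tensor_add_right[of x "\<zero>\<^bsub>P\<^esub>" "\<zero>\<^bsub>P\<^esub>"] assms ker_closed(3)[of "- frag_of (x, \<zero>\<^bsub>P\<^esub>)"]
  by (simp add: tensor_eq_def)

text \<open>Elements of \<open>I\<close> can be moved from \<open>x\<close> across the tensor sign, where they annihilate \<open>y\<close>.\<close>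

lemma tensor_ideal_smult_zero:
  assumes I: "ideal I R" and y: "y \<in> carrier P" "\<And>a. a \<in> I \<Longrightarrow> a \<odot>\<^bsub>P\<^esub> y = \<zero>\<^bsub>P\<^esub>"
    and x: "x \<in> ideal_smult M I"
  shows "frag_of (x, y) \<in> tensor_ker R M P"
proof -
  interpret I: ideal I R by fact
  note sub = I.a_subset
  have sc: "z \<in> ideal_smult M I \<Longrightarrow> z \<in> carrier M" for z
    using M.ideal_smult_carrier[OF sub] by blast
  show ?thesis using sub x
  proof (induction rule: M.ideal_smult_induct)
    case zero
    then show ?case using tensor_zero_left y by simp
  next
    case (gen a x)
    then have "frag_of (a \<odot>\<^bsub>M\<^esub> x, y) \<approx>\<^sub>\<otimes> frag_of (x, a \<odot>\<^bsub>P\<^esub> y)" using sub y by (intro tensor_smult) auto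
    then show ?case using tensor_zero_right[OF gen(2)] y(2)[OF gen(1)] mem_ker_cong by simp
  next
    case (add x x')
    then show ?case using mem_ker_cong[OF tensor_add_left] ker_closed(2) sc y(1) by blast
  next
    case (uminus x)
    have "frag_of (x \<oplus>\<^bsub>M\<^esub> (\<ominus>\<^bsub>M\<^esub> x), y) \<approx>\<^sub>\<otimes> frag_of (x, y) + frag_of (\<ominus>\<^bsub>M\<^esub> x, y)"
      using sc[OF uminus(1)] y(1) by (intro tensor_add_left) auto
    then have "frag_of (x, y) + frag_of (\<ominus>\<^bsub>M\<^esub> x, y) \<in> tensor_ker R M P"
      using mem_ker_cong tensor_zero_left[OF y(1)] sc[OF uminus(1)] by (simp add: M.M.r_neg)
    from ker_closed(4)[OF this uminus(2)] show ?case by simp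
  qed
qed

text \<open>
  Nonvanishing of \<open>x \<otimes> y\<close> is detected by biadditive balanced maps.  Values are only required to
  be biadditive and balanced modulo a subgroup \<open>H\<close>; this replaces maps into a quotient group.
\<close>

lemma tensor_zero_lift:
  assumes N: "abelian_group N" and H: "subgroup H (add_monoid N)"
    and g: "\<And>x y. x \<in> carrier M \<Longrightarrow> y \<in> carrier P \<Longrightarrow> g x y \<in> carrier N"
    and addl: "\<And>x x' y. x \<in> carrier M \<Longrightarrow> x' \<in> carrier M \<Longrightarrow> y \<in> carrier P \<Longrightarrow>
      g (x \<oplus>\<^bsub>M\<^esub> x') y \<ominus>\<^bsub>N\<^esub> (g x y \<oplus>\<^bsub>N\<^esub> g x' y) \<in> H"
    and addr: "\<And>x y y'. x \<in> carrier M \<Longrightarrow> y \<in> carrier P \<Longrightarrow> y' \<in> carrier P \<Longrightarrow>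
      g x (y \<oplus>\<^bsub>P\<^esub> y') \<ominus>\<^bsub>N\<^esub> (g x y \<oplus>\<^bsub>N\<^esub> g x y') \<in> H"
    and bal: "\<And>a x y. a \<in> carrier R \<Longrightarrow> x \<in> carrier M \<Longrightarrow> y \<in> carrier P \<Longrightarrow>
      g (a \<odot>\<^bsub>M\<^esub> x) y \<ominus>\<^bsub>N\<^esub> g x (a \<odot>\<^bsub>P\<^esub> y) \<in> H"
    and xy: "x \<in> carrier M" "y \<in> carrier P" "frag_of (x, y) \<in> tensor_ker R M P"
  shows "g x y \<in> H"
proof -
  interpret N: abelian_group N by fact
  let ?S = "carrier M \<times> carrier P"
  have cg: "comm_group (add_monoid N)" by (rule N.a_comm_group)
  obtain h where h: "h \<in> hom (free_Abelian_group ?S) (add_monoid N)"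
    and hg: "\<And>z. z \<in> ?S \<Longrightarrow> h (frag_of z) = (case z of (x, y) \<Rightarrow> g x y)"
  proof (rule comm_group.free_Abelian_group_universal[OF cg, of "\<lambda>(x, y). g x y" ?S])
    show "(\<lambda>(x, y). g x y) ` ?S \<subseteq> carrier (add_monoid N)" using g by auto
  qed blast
  interpret h: group_hom "free_Abelian_group ?S" "add_monoid N" h
    using h N.a_group by (simp add: group_hom_def group_hom_axioms_def)
  let ?K = "\<lambda>c. Poly_Mapping.keys c \<subseteq> ?S"
  have hcl: "h c \<in> carrier N" if "?K c" for c using h.hom_closed[of c] that by simp
  have hadd: "h (c + d) = h c \<oplus>\<^bsub>N\<^esub> h d" if "?K c" "?K d" for c d
    using h.hom_mult[of c d] that by simp
  have hminus: "h (- c) = \<ominus>\<^bsub>N\<^esub> h c" if "?K c" for c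
    using h.hom_inv[of c] that by (simp add: a_inv_def)
  have hdiff: "h (c - d) = h c \<ominus>\<^bsub>N\<^esub> h d" if "?K c" "?K d" for c d
    using hadd[of c "- d"] hminus[of d] that by (simp add: a_minus_def)
  have Kadd: "?K (c + d)" if "?K c" "?K d" for c d using keys_add[of c d] that by blast
  have h0: "h 0 = \<zero>\<^bsub>N\<^esub>" using h.hom_one by simp
  have "?K c \<and> h c \<in> H" if "c \<in> tensor_ker R M P" for c
    using M.module_axioms P.module_axioms that
  proof (induction rule: tensor_ker_induct)
    case zero
    then show ?case using subgroup.one_closed[OF H] h0 by simp
  next
    case (rel c)
    have K: "?K c"
      using tensor_ker_keys[OF M.module_axioms P.module_axioms tensor_ker_rels[OF rel]] .
    consider (a) x x' y where "c = frag_of (x \<oplus>\<^bsub>M\<^esub> x', y) - (frag_of (x, y) + frag_of (x', y))"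
        "x \<in> carrier M" "x' \<in> carrier M" "y \<in> carrier P"
      | (b) x y y' where "c = frag_of (x, y \<oplus>\<^bsub>P\<^esub> y') - (frag_of (x, y) + frag_of (x, y'))"
        "x \<in> carrier M" "y \<in> carrier P" "y' \<in> carrier P"
      | (s) a x y where "c = frag_of (a \<odot>\<^bsub>M\<^esub> x, y) - frag_of (x, a \<odot>\<^bsub>P\<^esub> y)"
        "a \<in> carrier R" "x \<in> carrier M" "y \<in> carrier P"
      using rel unfolding tensor_rels_def by blast
    then have "h c \<in> H"
    proof cases
      case a
      have "?K (frag_of (x, y) + frag_of (x', y))" using a by (intro Kadd) auto
      then show ?thesis using addl[OF a(2-4)] a by (simp add: hdiff hadd hg)
    next
      case b
      have "?K (frag_of (x, y) + frag_of (x, y'))" using b by (intro Kadd) auto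
      then show ?thesis using addr[OF b(2-4)] b by (simp add: hdiff hadd hg)
    next
      case s
      then show ?thesis using bal[OF s(2-4)] by (simp add: hdiff hg)
    qed
    with K show ?case by blast
  next
    case (add c d)
    then show ?case using Kadd[of c d] hadd[of c d] subgroup.m_closed[OF H, of "h c" "h d"] by simp
  next
    case (uminus c)
    then show ?case using hminus[of c] subgroup.m_inv_closed[OF H, of "h c"] by (simp add: a_inv_def)
  qed
  from this[OF xy(3)] show ?thesis using hg[of "(x, y)"] xy by simp
qed

end

text \<open>
  If \<open>x \<otimes> q = 0\<close>, flatness lets the tensor product be restricted to the submodule \<open>R q\<close>, which is
  \<open>R / Ann q\<close>; there the vanishing of \<open>x \<otimes> q\<close> says that \<open>x\<close> dies in \<open>M / (Ann q) M\<close>.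
\<close>

lemma flat_tensor_zero_imp_mem_annihilator_smult:
  assumes flat: "flat_module R M" and Q: "module R Q" and x: "x \<in> carrier M" and q: "q \<in> carrier Q"
    and xq: "frag_of (x, q) \<in> tensor_ker R M Q"
  shows "x \<in> ideal_smult M {a \<in> carrier R. a \<odot>\<^bsub>Q\<^esub> q = \<zero>\<^bsub>Q\<^esub>}"
proof -
  have M: "module R M" using flat by (simp add: flat_module_def)
  interpret M: module R M by fact
  interpret Q: module R Q by fact
  let ?A = "{a \<in> carrier R. a \<odot>\<^bsub>Q\<^esub> q = \<zero>\<^bsub>Q\<^esub>}"
  have A: "?A \<subseteq> carrier R" by blast
  let ?H = "(\<lambda>a. a \<odot>\<^bsub>Q\<^esub> q) ` carrier R"
  have sub: "submodule ?H R Q"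
  proof (rule Q.submoduleI)
    show "\<zero>\<^bsub>Q\<^esub> \<in> ?H" using q by (auto intro!: image_eqI[of _ _ "\<zero>\<^bsub>R\<^esub>"])
    show "\<ominus>\<^bsub>Q\<^esub> w \<in> ?H" if "w \<in> ?H" for w
      using that q by (auto simp: Q.smult_l_minus[symmetric])
    show "w \<oplus>\<^bsub>Q\<^esub> z \<in> ?H" if "w \<in> ?H" "z \<in> ?H" for w z
      using that q by (auto simp: Q.smult_l_distr[symmetric])
    show "a \<odot>\<^bsub>Q\<^esub> w \<in> ?H" if "a \<in> carrier R" "w \<in> ?H" for a w
      using that q by (auto simp: Q.smult_assoc1[symmetric])
  qed (use q in auto)
  let ?Q = "Q\<lparr>carrier := ?H\<rparr>"
  have Q': "module R ?Q" using submodule.submodule_is_module[OF sub Q] .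
  interpret T: tensor_pair R ?Q M using Q' M by (simp add: tensor_pair_def)
  have qH: "q \<in> ?H" using q by (auto intro!: image_eqI[of _ _ "\<one>\<^bsub>R\<^esub>"])
  have "frag_of (q, x) \<in> tensor_ker R Q M"
    using tensor_ker_swap[OF M Q xq] by simp
  moreover have "inj_on (tensor_map R ?Q Q M id) (carrier (tensor R ?Q M))"
    by (rule flat_module_any[OF flat Q' Q inclusion_linear[OF sub]]) simp
  ultimately have ker: "frag_of (q, x) \<in> tensor_ker R ?Q M"
    using x qH unfolding inj_on_tensor_map_iff[OF Q' Q M inclusion_linear[OF sub]]
    by simp
  \<comment> \<open>The inverse of the isomorphism \<open>R / Ann q = R q\<close>, as a choice of representatives.\<close>
  define r where "r w = (SOME a. a \<in> carrier R \<and> a \<odot>\<^bsub>Q\<^esub> q = w)" for w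
  have r: "r w \<in> carrier R" "r w \<odot>\<^bsub>Q\<^esub> q = w" if "w \<in> ?H" for w
  proof -
    have "\<exists>a. a \<in> carrier R \<and> a \<odot>\<^bsub>Q\<^esub> q = w" using that by blast
    from someI_ex[OF this] show "r w \<in> carrier R" "r w \<odot>\<^bsub>Q\<^esub> q = w" by (simp_all add: r_def)
  qed
  have diff: "b \<odot>\<^bsub>M\<^esub> y \<ominus>\<^bsub>M\<^esub> c \<odot>\<^bsub>M\<^esub> y \<in> ideal_smult M ?A"
    if "b \<in> carrier R" "c \<in> carrier R" "b \<odot>\<^bsub>Q\<^esub> q = c \<odot>\<^bsub>Q\<^esub> q" "y \<in> carrier M" for b c y
  proof -
    have "b \<odot>\<^bsub>M\<^esub> y \<ominus>\<^bsub>M\<^esub> c \<odot>\<^bsub>M\<^esub> y = (b \<ominus>\<^bsub>R\<^esub> c) \<odot>\<^bsub>M\<^esub> y"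
      using that by (simp add: a_minus_def M.smult_l_distr M.smult_l_minus)
    moreover have "b \<ominus>\<^bsub>R\<^esub> c \<in> ?A"
      using that q by (simp add: a_minus_def Q.smult_l_distr Q.smult_l_minus Q.M.r_neg)
    ultimately show ?thesis using M.ideal_smult_gen that(4) by metis
  qed
  have "r q \<odot>\<^bsub>M\<^esub> x \<in> ideal_smult M ?A"
  proof (rule T.tensor_zero_lift[where g = "\<lambda>w y. r w \<odot>\<^bsub>M\<^esub> y"])
    show "abelian_group M" by (rule M.abelian_group_axioms)
    show "subgroup (ideal_smult M ?A) (add_monoid M)" by (rule M.ideal_smult_subgroup[OF A])
    show "r w \<odot>\<^bsub>M\<^esub> y \<in> carrier M" if "w \<in> carrier ?Q" "y \<in> carrier M" for w y
      using that r by simp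
    show "r (w \<oplus>\<^bsub>?Q\<^esub> w') \<odot>\<^bsub>M\<^esub> y \<ominus>\<^bsub>M\<^esub> (r w \<odot>\<^bsub>M\<^esub> y \<oplus>\<^bsub>M\<^esub> r w' \<odot>\<^bsub>M\<^esub> y) \<in> ideal_smult M ?A"
      if "w \<in> carrier ?Q" "w' \<in> carrier ?Q" "y \<in> carrier M" for w w' y
    proof -
      have H: "w \<in> ?H" "w' \<in> ?H" "w \<oplus>\<^bsub>Q\<^esub> w' \<in> ?H" using that Q.submoduleE(5)[OF sub] by simp_all
      have "r (w \<oplus>\<^bsub>Q\<^esub> w') \<odot>\<^bsub>M\<^esub> y \<ominus>\<^bsub>M\<^esub> (r w \<oplus>\<^bsub>R\<^esub> r w') \<odot>\<^bsub>M\<^esub> y \<in> ideal_smult M ?A"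
        using r[OF H(1)] r[OF H(2)] r[OF H(3)] that(3) q
        by (intro diff) (simp_all add: Q.smult_l_distr)
      then show ?thesis using r[OF H(1)] r[OF H(2)] that(3) by (simp add: M.smult_l_distr)
    qed
    show "r w \<odot>\<^bsub>M\<^esub> (y \<oplus>\<^bsub>M\<^esub> y') \<ominus>\<^bsub>M\<^esub> (r w \<odot>\<^bsub>M\<^esub> y \<oplus>\<^bsub>M\<^esub> r w \<odot>\<^bsub>M\<^esub> y') \<in> ideal_smult M ?A"
      if "w \<in> carrier ?Q" "y \<in> carrier M" "y' \<in> carrier M" for w y y'
      using that r M.ideal_smult_closed(1)[OF A] by (simp add: M.smult_r_distr a_minus_def M.M.r_neg)
    show "r (a \<odot>\<^bsub>?Q\<^esub> w) \<odot>\<^bsub>M\<^esub> y \<ominus>\<^bsub>M\<^esub> r w \<odot>\<^bsub>M\<^esub> (a \<odot>\<^bsub>M\<^esub> y) \<in> ideal_smult M ?A"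
      if "a \<in> carrier R" "w \<in> carrier ?Q" "y \<in> carrier M" for a w y
    proof -
      have H: "w \<in> ?H" "a \<odot>\<^bsub>Q\<^esub> w \<in> ?H" using that Q.submoduleE(4)[OF sub] by simp_all
      have "r (a \<odot>\<^bsub>Q\<^esub> w) \<odot>\<^bsub>M\<^esub> y \<ominus>\<^bsub>M\<^esub> (a \<otimes>\<^bsub>R\<^esub> r w) \<odot>\<^bsub>M\<^esub> y \<in> ideal_smult M ?A"
        using r[OF H(1)] r[OF H(2)] that q by (intro diff) (simp_all add: Q.smult_assoc1)
      moreover have "(a \<otimes>\<^bsub>R\<^esub> r w) \<odot>\<^bsub>M\<^esub> y = r w \<odot>\<^bsub>M\<^esub> (a \<odot>\<^bsub>M\<^esub> y)"
        using r[OF H(1)] that by (simp add: M.smult_assoc1[symmetric] M.R.m_comm)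
      ultimately show ?thesis by simp
    qed
  qed (use x qH ker in simp_all)
  moreover have "\<one>\<^bsub>R\<^esub> \<odot>\<^bsub>M\<^esub> x \<ominus>\<^bsub>M\<^esub> r q \<odot>\<^bsub>M\<^esub> x \<in> ideal_smult M ?A"
    using r[OF qH] x q by (intro diff) simp_all
  ultimately have "(\<one>\<^bsub>R\<^esub> \<odot>\<^bsub>M\<^esub> x \<ominus>\<^bsub>M\<^esub> r q \<odot>\<^bsub>M\<^esub> x) \<oplus>\<^bsub>M\<^esub> r q \<odot>\<^bsub>M\<^esub> x \<in> ideal_smult M ?A"
    by (intro M.ideal_smult_closed(2)[OF A])
  then show ?thesis using r[OF qH] x by (simp add: a_minus_def M.M.a_assoc M.M.l_neg)
qed

text \<open>
  A tensor product with a cyclic module consists of pure tensors \<open>e \<otimes> q\<close>, so injectivity need only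
  be tested on those.
\<close>

lemma pure_map_cyclicI:
  fixes R :: "('r, 'c) ring_scheme" and L :: "('r, 'l, 'd) module_scheme"
    and N :: "('r, 'n, 'e) module_scheme"
  assumes L: "module R L" and N: "module R N" and v: "v \<in> linear_maps R L N"
    and e: "e \<in> carrier L" "\<And>y. y \<in> carrier L \<Longrightarrow> \<exists>a\<in>carrier R. y = a \<odot>\<^bsub>L\<^esub> e"
    and zero: "\<And>(P :: ('r, 'r univ) module) q. module R P \<Longrightarrow> q \<in> carrier P \<Longrightarrow>
      frag_of (v e, q) \<in> tensor_ker R N P \<Longrightarrow> q = \<zero>\<^bsub>P\<^esub>"
  shows "pure_map R L N v"
  unfolding pure_map_def
proof (intro conjI v allI impI)
  fix P :: "('r, 'r univ) module" assume P: "module R P"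
  interpret L: tensor_pair R L P using L P by (simp add: tensor_pair_def)
  interpret N: tensor_pair R N P using N P by (simp add: tensor_pair_def)
  have cyclic: "\<exists>q\<in>carrier P. L.tensor_eq c (frag_of (e, q))"
    if "Poly_Mapping.keys c \<subseteq> carrier L \<times> carrier P" for c
    using that
  proof (induction c rule: frag_induction)
    case zero
    then show ?case
      using L.tensor_zero_right[OF e(1)] L.eq_sym L.eq_zero_iff by blast
  next
    case (one z)
    then obtain y w where z: "z = (y, w)" "y \<in> carrier L" "w \<in> carrier P" by blast
    obtain a where a: "a \<in> carrier R" "y = a \<odot>\<^bsub>L\<^esub> e" using e(2) z by blast
    then have "L.tensor_eq (frag_of z) (frag_of (e, a \<odot>\<^bsub>P\<^esub> w))"
      using L.tensor_smult[of a e w] e(1) z by simp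
    then show ?case using a z by blast
  next
    case (diff a b)
    then obtain q q' where q: "q \<in> carrier P" "q' \<in> carrier P"
      "L.tensor_eq a (frag_of (e, q))" "L.tensor_eq b (frag_of (e, q'))" by blast
    then have "L.tensor_eq (a - b) (frag_of (e, q) - frag_of (e, q'))" by (intro L.eq_diff)
    also have "L.tensor_eq \<dots> (frag_of (e, q \<ominus>\<^bsub>P\<^esub> q'))"
      using L.tensor_diff_right[OF e(1)] q by blast
    finally show ?case using q L.P.M.minus_closed by blast
  qed
  show "inj_on (tensor_map R L N P v) (carrier (tensor R L P))"
    unfolding inj_on_tensor_map_iff[OF L N P v]
  proof (intro allI impI)
    fix c assume c: "Poly_Mapping.keys c \<subseteq> carrier L \<times> carrier P"
      and k: "frag_push (map_prod v id) c \<in> tensor_ker R N P"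
    obtain q where q: "q \<in> carrier P" "L.tensor_eq c (frag_of (e, q))" using cyclic[OF c] by blast
    then have "frag_push (map_prod v id) (c - frag_of (e, q)) \<in> tensor_ker R N P"
      using tensor_ker_push[OF L P N P v id_linear(2)] by (simp add: L.tensor_eq_def)
    from N.ker_closed(4)[OF k this] have "frag_of (v e, q) \<in> tensor_ker R N P"
      by (simp add: frag_extend_diff)
    then have "q = \<zero>\<^bsub>P\<^esub>" using zero[OF P q(1)] by blast
    then show "c \<in> tensor_ker R L P"
      using L.mem_ker_cong[OF q(2)] L.tensor_zero_right[OF e(1)] by simp
  qed
qed


section \<open>Localization\<close>

definition restrict_scalars ::
  "('r \<Rightarrow> 'a) \<Rightarrow> ('a, 'm, 'd) module_scheme \<Rightarrow> ('r, 'm) module"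
  where "restrict_scalars h P =
    \<lparr>carrier = carrier P, monoid.mult = monoid.mult P, one = one P, ring.zero = ring.zero P,
     add = add P, smult = (\<lambda>a. smult P (h a))\<rparr>"

lemma restrict_scalars_simps [simp]:
  "carrier (restrict_scalars h P) = carrier P" "add (restrict_scalars h P) = add P"
  "ring.zero (restrict_scalars h P) = ring.zero P"
  "a \<odot>\<^bsub>restrict_scalars h P\<^esub> x = h a \<odot>\<^bsub>P\<^esub> x"
  by (simp_all add: restrict_scalars_def)

lemma module_restrict_scalars:
  assumes R: "cring R" and h: "h \<in> ring_hom R A" and P: "module A P"
  shows "module R (restrict_scalars h P)"
proof -
  interpret P: module A P by fact
  interpret R: cring R by fact
  show ?thesis
  proof (rule moduleI)
    show "abelian_group (restrict_scalars h P)"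
      by (rule abelian_groupI) (auto simp: P.M.a_ac intro: P.M.l_neg bexI[of _ "\<ominus>\<^bsub>P\<^esub> _"])
  qed (use h in \<open>auto simp: R ring_hom_closed ring_hom_add ring_hom_mult ring_hom_one
      P.smult_l_distr P.smult_r_distr P.smult_assoc1\<close>)
qed

context cring_loc
begin

abbreviation fraction :: "'r \<Rightarrow> 'r \<Rightarrow> ('r \<times> 'r) set" (infixl \<open>\<div>\<close> 75)
  where "a \<div> s \<equiv> loc_frac R (regular_module R) S a s"

lemma S_in_carrier: "s \<in> S \<Longrightarrow> s \<in> carrier R" using S_sub by blast

lemma fraction_closed: "a \<in> carrier R \<Longrightarrow> s \<in> S \<Longrightarrow> a \<div> s \<in> carrier (loc_ring R S)"
  using reg.frac_closed[of a s] by (simp add: loc_ring_simps)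

lemma fraction_cases:
  assumes "X \<in> carrier (loc_ring R S)"
  obtains a s where "a \<in> carrier R" "s \<in> S" "X = a \<div> s"
  using assms reg.loc_cases[of X] by (auto simp: loc_ring_simps)

lemma fraction_eqI:
  "a \<in> carrier R \<Longrightarrow> b \<in> carrier R \<Longrightarrow> s \<in> S \<Longrightarrow> t \<in> S \<Longrightarrow> t \<otimes> a = s \<otimes> b \<Longrightarrow> a \<div> s = b \<div> t"
  using reg.frac_eqI[of a b s t] by simp

lemma fraction_one: "\<one>\<^bsub>loc_ring R S\<^esub> = \<one> \<div> \<one>"
  by (simp add: loc_ring_def)

lemma fraction_add:
  "a \<in> carrier R \<Longrightarrow> b \<in> carrier R \<Longrightarrow> s \<in> S \<Longrightarrow> t \<in> S \<Longrightarrow>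
    a \<div> s \<oplus>\<^bsub>loc_ring R S\<^esub> b \<div> t = (t \<otimes> a \<oplus> s \<otimes> b) \<div> (s \<otimes> t)"
  using reg.loc_add[of a b s t] by (simp add: loc_ring_simps)

lemma loc_ring_hom: "(\<lambda>a. a \<div> \<one>) \<in> ring_hom R (loc_ring R S)"
  by (rule ring_hom_memI) (auto simp: fraction_closed loc_mult fraction_add fraction_one S_one)

definition loc_ideal :: "'r set \<Rightarrow> ('r \<times> 'r) set set"
  where "loc_ideal I = {a \<div> s | a s. a \<in> I \<and> s \<in> S}"

lemma loc_idealI: "a \<in> I \<Longrightarrow> s \<in> S \<Longrightarrow> a \<div> s \<in> loc_ideal I"
  unfolding loc_ideal_def by blast

lemma loc_ideal: assumes "ideal I R" shows "ideal (loc_ideal I) (loc_ring R S)"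
proof -
  interpret I: ideal I R by fact
  interpret A: cring "loc_ring R S" by (rule cring_loc_ring)
  have sub: "loc_ideal I \<subseteq> carrier (loc_ring R S)"
    using I.a_subset by (auto simp: loc_ideal_def intro!: fraction_closed)
  have mult: "Y \<otimes>\<^bsub>loc_ring R S\<^esub> X \<in> loc_ideal I"
    if X: "X \<in> loc_ideal I" and Y: "Y \<in> carrier (loc_ring R S)" for X Y
  proof -
    obtain a s where a: "a \<in> I" "s \<in> S" "X = a \<div> s" using X by (auto simp: loc_ideal_def)
    obtain b t where b: "b \<in> carrier R" "t \<in> S" "Y = b \<div> t" using Y by (rule fraction_cases)
    have "Y \<otimes>\<^bsub>loc_ring R S\<^esub> X = (b \<otimes> a) \<div> (t \<otimes> s)"
      using a b I.a_subset by (auto simp: loc_mult)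
    then show ?thesis using loc_idealI[OF I.I_l_closed[OF a(1) b(1)] S_mult[OF b(2) a(2)]] by simp
  qed
  show ?thesis
  proof (rule idealI)
    show "subgroup (loc_ideal I) (add_monoid (loc_ring R S))"
    proof (rule group.subgroupI[OF A.a_group])
      show "loc_ideal I \<noteq> {}" using loc_idealI[OF I.zero_closed S_one] by blast
      show "inv\<^bsub>add_monoid (loc_ring R S)\<^esub> X \<in> loc_ideal I" if "X \<in> loc_ideal I" for X
      proof -
        have "\<ominus>\<^bsub>loc_ring R S\<^esub> X = (\<ominus>\<^bsub>loc_ring R S\<^esub> \<one>\<^bsub>loc_ring R S\<^esub>) \<otimes>\<^bsub>loc_ring R S\<^esub> X"
          using subsetD[OF sub that] by (simp add: A.l_minus)
        then have "\<ominus>\<^bsub>loc_ring R S\<^esub> X \<in> loc_ideal I"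
          using mult[OF that, of "\<ominus>\<^bsub>loc_ring R S\<^esub> \<one>\<^bsub>loc_ring R S\<^esub>"] by simp
        then show ?thesis by (simp only: a_inv_def)
      qed
      show "X \<otimes>\<^bsub>add_monoid (loc_ring R S)\<^esub> Y \<in> loc_ideal I"
        if X: "X \<in> loc_ideal I" and Y: "Y \<in> loc_ideal I" for X Y
      proof -
        obtain a s where a: "a \<in> I" "s \<in> S" "X = a \<div> s" using X by (auto simp: loc_ideal_def)
        obtain b t where b: "b \<in> I" "t \<in> S" "Y = b \<div> t" using Y by (auto simp: loc_ideal_def)
        have "X \<oplus>\<^bsub>loc_ring R S\<^esub> Y = (t \<otimes> a \<oplus> s \<otimes> b) \<div> (s \<otimes> t)"
          using a b I.a_subset by (auto simp: fraction_add)
        moreover have "t \<otimes> a \<oplus> s \<otimes> b \<in> I"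
          using a b S_in_carrier by (intro I.a_closed I.I_l_closed) auto
        ultimately show ?thesis using loc_idealI S_mult[OF a(2) b(2)] by simp
      qed
    qed (use sub in simp)
    show "X \<otimes>\<^bsub>loc_ring R S\<^esub> Y \<in> loc_ideal I"
      if "X \<in> loc_ideal I" "Y \<in> carrier (loc_ring R S)" for X Y
      using mult[OF that] A.m_comm[of X Y] subsetD[OF sub that(1)] that(2) by simp
  qed (use mult A.ring_axioms in auto)
qed

text \<open>A prime that avoids \<open>S\<close> is the contraction of its extension.\<close>

lemma mem_loc_ideal_prime:
  assumes q: "primeideal q R" "q \<inter> S = {}" and a: "a \<in> carrier R" "s \<in> S"
    and mem: "a \<div> s \<in> loc_ideal q"
  shows "a \<in> q"
proof -
  interpret q: primeideal q R by fact
  obtain b t where b: "b \<in> q" "t \<in> S" "a \<div> s = b \<div> t" using mem by (auto simp: loc_ideal_def)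
  have c: "b \<in> carrier R" using b q.a_subset by auto
  obtain u where u: "u \<in> S" "u \<otimes> (t \<otimes> a) = u \<otimes> (s \<otimes> b)"
    using reg.frac_eq_iff[of a b s t] a b c by auto
  have "(u \<otimes> t) \<otimes> a = u \<otimes> (s \<otimes> b)" using u a b S_in_carrier by (simp add: R.m_assoc)
  also have "\<dots> \<in> q" using b(1) a u(1) S_in_carrier by (intro q.I_l_closed) auto
  finally have "u \<otimes> t \<in> q \<or> a \<in> q" using q.I_prime[of "u \<otimes> t" a] u(1) b(2) a(1) S_in_carrier by auto
  then show ?thesis using S_mult[OF u(1) b(2)] q(2) by blast
qed

end

context mod_loc
begin

lemma frac_add_one:
  "x \<in> carrier M \<Longrightarrow> y \<in> carrier M \<Longrightarrow>
    loc_frac R M S x \<one> \<oplus>\<^bsub>loc_module R M S\<^esub> loc_frac R M S y \<one> = loc_frac R M S (x \<oplus>\<^bsub>M\<^esub> y) \<one>"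
  by (simp add: loc_add)

lemma frac_uminus:
  assumes "x \<in> carrier M" "s \<in> S"
  shows "\<ominus>\<^bsub>loc_module R M S\<^esub> loc_frac R M S x s = loc_frac R M S (\<ominus>\<^bsub>M\<^esub> x) s"
proof -
  interpret L: abelian_group "loc_module R M S" by (rule abelian_group_loc_module)
  have "loc_frac R M S (\<ominus>\<^bsub>M\<^esub> x) s \<oplus>\<^bsub>loc_module R M S\<^esub> loc_frac R M S x s = \<zero>\<^bsub>loc_module R M S\<^esub>"
    using assms by (simp add: loc_zero loc_add smult_r_minus M.l_neg) (rule frac_eqI, auto)
  then show ?thesis using assms by (intro L.minus_equality frac_closed) auto
qed

lemma ideal_smult_loc:
  assumes I: "ideal I R" and x: "x \<in> ideal_smult M I"
  shows "loc_frac R M S x \<one> \<in> ideal_smult (loc_module R M S) (loc_ideal I)"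
proof -
  interpret L: module "loc_ring R S" "loc_module R M S" by (rule module_loc_module)
  interpret I: ideal I R by fact
  interpret LI: ideal "loc_ideal I" "loc_ring R S" using loc_ideal[OF I] .
  have sc: "z \<in> ideal_smult M I \<Longrightarrow> z \<in> carrier M" for z
    using ideal_smult_carrier[OF I.a_subset] by blast
  note cl = L.ideal_smult_closed[OF LI.a_subset]
  show ?thesis using I.a_subset x
  proof (induction rule: ideal_smult_induct)
    case zero
    then show ?case using cl(1) by (simp add: loc_zero)
  next
    case (gen a x)
    have "a \<div> \<one> \<in> loc_ideal I" using gen(1) S_one by (rule loc_idealI)
    moreover have "loc_frac R M S (a \<odot>\<^bsub>M\<^esub> x) \<one>
      = (a \<div> \<one>) \<odot>\<^bsub>loc_module R M S\<^esub> loc_frac R M S x \<one>"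
      using gen I.a_subset by (auto simp: loc_smult)
    ultimately show ?case using L.ideal_smult_gen gen(2) by (simp add: frac_closed)
  next
    case (add x y)
    then show ?case using cl(2) sc by (simp flip: frac_add_one)
  next
    case (uminus x)
    then show ?case using cl(3) sc by (simp flip: frac_uminus)
  qed
qed

text \<open>
  The hypothesis on \<open>C\<close> says that \<open>C\<close> is contained in the extension of \<open>J\<close> to the localization.
  Clearing denominators in an expression of \<open>x/1\<close> with coefficients in \<open>C\<close> moves all of them into \<open>J\<close>.
\<close>

lemma ideal_smult_loc_clear_denominators:
  assumes J: "ideal J R" and C: "C \<subseteq> carrier (loc_ring R S)"
    and CJ: "\<And>a s. a \<in> carrier R \<Longrightarrow> s \<in> S \<Longrightarrow> a \<div> s \<in> C \<Longrightarrow> \<exists>u\<in>S. u \<otimes> a \<in> J"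
    and x: "x \<in> carrier M" "loc_frac R M S x \<one> \<in> ideal_smult (loc_module R M S) C"
  shows "\<exists>u\<in>S. u \<odot>\<^bsub>M\<^esub> x \<in> ideal_smult M J"
proof -
  interpret L: module "loc_ring R S" "loc_module R M S" by (rule module_loc_module)
  interpret J: ideal J R by fact
  note cl = ideal_smult_closed[OF J.a_subset] ideal_smult_smult_closed[OF J]
  have sc: "z \<in> carrier M" if "z \<in> ideal_smult M J" for z
    using that ideal_smult_carrier[OF J.a_subset] by blast
  have "\<exists>y s. y \<in> ideal_smult M J \<and> s \<in> S \<and> z = loc_frac R M S y s"
    if "z \<in> ideal_smult (loc_module R M S) C" for z
    using C that
  proof (induction rule: L.ideal_smult_induct)
    case zero
    then show ?case using cl(1) S_one loc_zero by blast
  next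
    case (gen c z)
    obtain a s where a: "a \<in> carrier R" "s \<in> S" "c = a \<div> s"
      using fraction_cases gen(1) C by blast
    obtain y t where y: "y \<in> carrier M" "t \<in> S" "z = loc_frac R M S y t"
      using loc_cases gen(2) by blast
    obtain u where u: "u \<in> S" "u \<otimes> a \<in> J" using CJ a gen(1) by blast
    have "c \<odot>\<^bsub>loc_module R M S\<^esub> z = loc_frac R M S (a \<odot>\<^bsub>M\<^esub> y) (s \<otimes> t)"
      using a y by (simp add: loc_smult)
    also have "\<dots> = loc_frac R M S ((u \<otimes> a) \<odot>\<^bsub>M\<^esub> y) (u \<otimes> (s \<otimes> t))"
      using a y u by (intro frac_eqI) (auto simp: smult_assoc1[symmetric] R.m_ac)
    finally show ?case using ideal_smult_gen[OF u(2) y(1)] S_mult[OF u(1) S_mult[OF a(2) y(2)]] by blast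
  next
    case (add z w)
    then obtain y s y' t where *: "y \<in> ideal_smult M J" "s \<in> S" "z = loc_frac R M S y s"
      "y' \<in> ideal_smult M J" "t \<in> S" "w = loc_frac R M S y' t" by blast
    then have "z \<oplus>\<^bsub>loc_module R M S\<^esub> w = loc_frac R M S (t \<odot>\<^bsub>M\<^esub> y \<oplus>\<^bsub>M\<^esub> s \<odot>\<^bsub>M\<^esub> y') (s \<otimes> t)"
      using sc by (simp add: loc_add)
    moreover have "t \<odot>\<^bsub>M\<^esub> y \<oplus>\<^bsub>M\<^esub> s \<odot>\<^bsub>M\<^esub> y' \<in> ideal_smult M J"
      using * by (intro cl(2) cl(4)) auto
    ultimately show ?case using S_mult[OF *(2,5)] by blast
  next
    case (uminus z)
    then show ?case using cl(3) frac_uminus sc by blast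
  qed
  then obtain y s where y: "y \<in> ideal_smult M J" "s \<in> S" "loc_frac R M S x \<one> = loc_frac R M S y s"
    using x(2) by blast
  then obtain u where u: "u \<in> S" "u \<odot>\<^bsub>M\<^esub> (s \<odot>\<^bsub>M\<^esub> x) = u \<odot>\<^bsub>M\<^esub> (\<one> \<odot>\<^bsub>M\<^esub> y)"
    using frac_eq_iff[of x y \<one> s] x(1) sc by auto
  then have "(u \<otimes> s) \<odot>\<^bsub>M\<^esub> x \<in> ideal_smult M J"
    using y x(1) sc cl(4)[of u y] by (simp add: smult_assoc1)
  then show ?thesis using S_mult[OF u(1) y(2)] by blast
qed

text \<open>
  One half of the isomorphism \<open>S\<^sup>-\<^sup>1M \<otimes> P = M \<otimes> P\<close> for a module \<open>P\<close> over \<open>S\<^sup>-\<^sup>1R\<close>, on the right over \<open>R\<close>: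
  the map \<open>y/s \<otimes> q \<mapsto> y \<otimes> (1/s) q\<close> is well defined and sends \<open>x/1 \<otimes> q\<close> to \<open>x \<otimes> q\<close>.
\<close>

lemma tensor_zero_of_loc_tensor_zero:
  assumes P: "module (loc_ring R S) P" and x: "x \<in> carrier M" and q: "q \<in> carrier P"
    and ker: "frag_of (loc_frac R M S x \<one>, q) \<in> tensor_ker (loc_ring R S) (loc_module R M S) P"
  shows "frag_of (x, q) \<in> tensor_ker R M (restrict_scalars (\<lambda>a. a \<div> \<one>) P)"
proof -
  let ?A = "loc_ring R S" and ?L = "loc_module R M S"
  let ?Q = "restrict_scalars (\<lambda>a. a \<div> \<one>) P"
  interpret P: module ?A P by fact
  have Q: "module R ?Q" by (rule module_restrict_scalars[OF R.is_cring loc_ring_hom P])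
  interpret T: tensor_pair R M ?Q using Q module_axioms by (simp add: tensor_pair_def)
  have L: "module ?A ?L" by (rule module_loc_module)
  define E where "E y s w = frag_of (y, (\<one> \<div> s) \<odot>\<^bsub>P\<^esub> w)" for y :: 'm and s w
  have fc: "a \<div> s \<in> carrier ?A" if "a \<in> carrier R" "s \<in> S" for a s using that by (rule fraction_closed)
  have sm: "(a \<div> s) \<odot>\<^bsub>P\<^esub> ((b \<div> t) \<odot>\<^bsub>P\<^esub> w) = ((a \<otimes> b) \<div> (s \<otimes> t)) \<odot>\<^bsub>P\<^esub> w"
    if "a \<in> carrier R" "b \<in> carrier R" "s \<in> S" "t \<in> S" "w \<in> carrier P" for a b s t w
    using that by (simp add: P.smult_assoc1[symmetric] fc loc_mult)
  \<comment> \<open>The tensor \<open>y \<otimes> (1/s) w\<close> only depends on the fraction \<open>y/s\<close>, since it does not change when the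
     fraction is expanded; so an arbitrary choice of representatives gives a well-defined map.\<close>
  have E_expand: "T.tensor_eq (E (t \<odot>\<^bsub>M\<^esub> y) (t \<otimes> s) w) (E y s w)"
    if "y \<in> carrier M" "s \<in> S" "t \<in> S" "w \<in> carrier P" for y s t w
  proof -
    have "T.tensor_eq (E (t \<odot>\<^bsub>M\<^esub> y) (t \<otimes> s) w) (frag_of (y, t \<odot>\<^bsub>?Q\<^esub> ((\<one> \<div> (t \<otimes> s)) \<odot>\<^bsub>P\<^esub> w)))"
      unfolding E_def using that by (intro T.tensor_smult) (auto simp: fc)
    moreover have "t \<odot>\<^bsub>?Q\<^esub> ((\<one> \<div> (t \<otimes> s)) \<odot>\<^bsub>P\<^esub> w) = (t \<div> (t \<otimes> s)) \<odot>\<^bsub>P\<^esub> w"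
      using that by (simp add: sm)
    moreover have "t \<div> (t \<otimes> s) = \<one> \<div> s"
      using that by (intro fraction_eqI) (auto simp: R.m_comm)
    ultimately show ?thesis by (simp add: E_def)
  qed
  have E_cong: "T.tensor_eq (E y s w) (E y' s' w)"
    if eq: "loc_frac R M S y s = loc_frac R M S y' s'"
      and c: "y \<in> carrier M" "s \<in> S" "y' \<in> carrier M" "s' \<in> S" "w \<in> carrier P" for y s y' s' w
  proof -
    obtain u where u: "u \<in> S" "u \<odot>\<^bsub>M\<^esub> (s' \<odot>\<^bsub>M\<^esub> y) = u \<odot>\<^bsub>M\<^esub> (s \<odot>\<^bsub>M\<^esub> y')"
      using eq c by (auto simp: frac_eq_iff)
    have "T.tensor_eq (E y s w) (E ((u \<otimes> s') \<odot>\<^bsub>M\<^esub> y) (u \<otimes> s' \<otimes> s) w)"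
      using c u by (intro T.eq_sym[OF E_expand]) auto
    also have "E ((u \<otimes> s') \<odot>\<^bsub>M\<^esub> y) (u \<otimes> s' \<otimes> s) w = E ((u \<otimes> s) \<odot>\<^bsub>M\<^esub> y') (u \<otimes> s \<otimes> s') w"
    proof -
      have "(u \<otimes> s') \<odot>\<^bsub>M\<^esub> y = (u \<otimes> s) \<odot>\<^bsub>M\<^esub> y'" using c u by (simp add: smult_assoc1)
      moreover have "u \<otimes> s' \<otimes> s = u \<otimes> s \<otimes> s'" using c u by (simp add: R.m_ac)
      ultimately show ?thesis by simp
    qed
    also have "T.tensor_eq \<dots> (E y' s' w)" using c u by (intro E_expand) auto
    finally show ?thesis .
  qed
  define rep where "rep Y = (SOME p. p \<in> carrier M \<times> S \<and> Y = loc_frac R M S (fst p) (snd p))" for Y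
  have rep: "fst (rep Y) \<in> carrier M \<and> snd (rep Y) \<in> S \<and> Y = loc_frac R M S (fst (rep Y)) (snd (rep Y))"
    if "Y \<in> carrier ?L" for Y
  proof -
    have "\<exists>p. p \<in> carrier M \<times> S \<and> Y = loc_frac R M S (fst p) (snd p)"
      using that by (elim loc_cases) auto
    from someI_ex[OF this] show ?thesis by (auto simp: rep_def)
  qed
  define F where "F = frag_extend (\<lambda>(Y, w). E (fst (rep Y)) (snd (rep Y)) w)"
  have F: "T.tensor_eq (F (frag_of (loc_frac R M S y s, w))) (E y s w)"
    if "y \<in> carrier M" "s \<in> S" "w \<in> carrier P" for y s w
    using rep[OF frac_closed[OF that(1,2)]] that by (simp add: F_def) (rule E_cong, auto)
  have F_add: "F (c + d) = F c + F d" and F_diff: "F (c - d) = F c - F d"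
    and F_minus: "F (- c) = - F c" for c d
    by (simp_all add: F_def frag_extend_add frag_extend_diff frag_extend_minus)
  have "F c \<in> tensor_ker R M ?Q" if "c \<in> tensor_ker ?A ?L P" for c
    using L P that
  proof (induction rule: tensor_ker_induct)
    case zero
    then show ?case by (simp add: F_def T.ker_closed(1))
  next
    case (rel c)
    consider (a) Y Z w where "c = frag_of (Y \<oplus>\<^bsub>?L\<^esub> Z, w) - (frag_of (Y, w) + frag_of (Z, w))"
        "Y \<in> carrier ?L" "Z \<in> carrier ?L" "w \<in> carrier P"
      | (b) Y w w' where "c = frag_of (Y, w \<oplus>\<^bsub>P\<^esub> w') - (frag_of (Y, w) + frag_of (Y, w'))"
        "Y \<in> carrier ?L" "w \<in> carrier P" "w' \<in> carrier P"
      | (s) A Y w where "c = frag_of (A \<odot>\<^bsub>?L\<^esub> Y, w) - frag_of (Y, A \<odot>\<^bsub>P\<^esub> w)"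
        "A \<in> carrier ?A" "Y \<in> carrier ?L" "w \<in> carrier P"
      using rel unfolding tensor_rels_def by blast
    then show ?case
    proof cases
      case a
      obtain y s where y: "y \<in> carrier M" "s \<in> S" "Y = loc_frac R M S y s" using a(2) by (rule loc_cases)
      obtain z t where z: "z \<in> carrier M" "t \<in> S" "Z = loc_frac R M S z t" using a(3) by (rule loc_cases)
      have "Y \<oplus>\<^bsub>?L\<^esub> Z = loc_frac R M S (t \<odot>\<^bsub>M\<^esub> y \<oplus>\<^bsub>M\<^esub> s \<odot>\<^bsub>M\<^esub> z) (s \<otimes> t)"
        using y z by (simp add: loc_add)
      then have "T.tensor_eq (F (frag_of (Y \<oplus>\<^bsub>?L\<^esub> Z, w))) (E (t \<odot>\<^bsub>M\<^esub> y \<oplus>\<^bsub>M\<^esub> s \<odot>\<^bsub>M\<^esub> z) (s \<otimes> t) w)"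
        using F[of "t \<odot>\<^bsub>M\<^esub> y \<oplus>\<^bsub>M\<^esub> s \<odot>\<^bsub>M\<^esub> z" "s \<otimes> t" w] y z a by simp
      also have "T.tensor_eq \<dots> (E (t \<odot>\<^bsub>M\<^esub> y) (s \<otimes> t) w + E (s \<odot>\<^bsub>M\<^esub> z) (s \<otimes> t) w)"
        unfolding E_def using y z a fc by (intro T.tensor_add_left) auto
      also have "T.tensor_eq \<dots> (E y s w + E z t w)"
        using E_expand[of y s t w] E_expand[of z t s w] y z a
        by (intro T.eq_add) (simp_all add: R.m_comm)
      also have "T.tensor_eq \<dots> (F (frag_of (Y, w)) + F (frag_of (Z, w)))"
        unfolding y(3) z(3) using F y z a by (intro T.eq_add T.eq_sym[OF F]) auto
      finally show ?thesis by (simp add: a F_add F_diff T.tensor_eq_def)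
    next
      case b
      have r: "fst (rep Y) \<in> carrier M" "snd (rep Y) \<in> S" using rep[OF b(2)] by auto
      have "T.tensor_eq (E (fst (rep Y)) (snd (rep Y)) (w \<oplus>\<^bsub>P\<^esub> w'))
          (E (fst (rep Y)) (snd (rep Y)) w + E (fst (rep Y)) (snd (rep Y)) w')"
        unfolding E_def
        using T.tensor_add_right[of "fst (rep Y)" "(\<one> \<div> snd (rep Y)) \<odot>\<^bsub>P\<^esub> w" "(\<one> \<div> snd (rep Y)) \<odot>\<^bsub>P\<^esub> w'"]
          r b fc by (simp add: P.smult_r_distr)
      then show ?thesis by (simp add: b F_def frag_extend_add frag_extend_diff T.tensor_eq_def)
    next
      case s
      obtain y t where y: "y \<in> carrier M" "t \<in> S" "Y = loc_frac R M S y t" using s(3) by (rule loc_cases)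
      obtain a r where a: "a \<in> carrier R" "r \<in> S" "A = a \<div> r" using s(2) by (rule fraction_cases)
      have "A \<odot>\<^bsub>?L\<^esub> Y = loc_frac R M S (a \<odot>\<^bsub>M\<^esub> y) (r \<otimes> t)" using y a by (simp add: loc_smult)
      then have "T.tensor_eq (F (frag_of (A \<odot>\<^bsub>?L\<^esub> Y, w))) (E (a \<odot>\<^bsub>M\<^esub> y) (r \<otimes> t) w)"
        using F[of "a \<odot>\<^bsub>M\<^esub> y" "r \<otimes> t" w] y a s by simp
      also have "T.tensor_eq \<dots> (frag_of (y, a \<odot>\<^bsub>?Q\<^esub> ((\<one> \<div> (r \<otimes> t)) \<odot>\<^bsub>P\<^esub> w)))"
        unfolding E_def using y a s fc by (intro T.tensor_smult) auto
      also have "a \<odot>\<^bsub>?Q\<^esub> ((\<one> \<div> (r \<otimes> t)) \<odot>\<^bsub>P\<^esub> w) = (\<one> \<div> t) \<odot>\<^bsub>P\<^esub> (A \<odot>\<^bsub>P\<^esub> w)"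
        using y a s by (simp add: sm R.m_comm)
      also have "frag_of (y, (\<one> \<div> t) \<odot>\<^bsub>P\<^esub> (A \<odot>\<^bsub>P\<^esub> w)) = E y t (A \<odot>\<^bsub>P\<^esub> w)" by (simp add: E_def)
      also have "T.tensor_eq \<dots> (F (frag_of (Y, A \<odot>\<^bsub>P\<^esub> w)))"
        unfolding y(3) using y s by (intro T.eq_sym[OF F]) auto
      finally show ?thesis by (simp add: s F_diff T.tensor_eq_def)
    qed
  qed (simp_all add: F_add F_minus T.ker_closed)
  from this[OF ker] have "E x \<one> q \<in> tensor_ker R M ?Q"
    using T.mem_ker_cong[OF F[of x \<one> q]] x q by simp
  moreover have "(\<one> \<div> \<one>) \<odot>\<^bsub>P\<^esub> q = q" using q fraction_one P.smult_one by metis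
  ultimately show ?thesis by (simp add: E_def)
qed

end


section \<open>The pure locus\<close>

context mod_loc
begin

text \<open>
  The residue module \<open>S\<^sup>-\<^sup>1(R/I)\<close> detects the failure of purity: if \<open>v(1) \<in> I M\<close> then tensoring the
  localized map with it gives zero, although the module is nonzero since \<open>I\<close> avoids \<open>S\<close>.
\<close>

lemma pure_loc_map_imp_notin_ideal_smult:
  assumes v: "v \<in> linear_maps R (regular_module R) M" and I: "ideal I R" "I \<inter> S = {}"
    and pure: "pure_map (loc_ring R S) (loc_module R (regular_module R) S) (loc_module R M S)
      (loc_map R M S v)"
  shows "v \<one> \<notin> ideal_smult M I"
proof
  assume mem: "v \<one> \<in> ideal_smult M I"
  interpret I: ideal I R by fact
  let ?A = "loc_ring R S" and ?L = "loc_module R (regular_module R) S" and ?N = "loc_module R M S"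
  let ?K = "restrict_scalars ((+>) I) (regular_module (R Quot I))"
  have hom: "(+>) I \<in> ring_hom R (R Quot I)" by (rule I.rcos_ring_hom)
  interpret F: cring "R Quot I" by (rule I.quotient_is_cring[OF R.is_cring])
  have P0: "module R ?K" by (rule module_restrict_scalars[OF R.is_cring hom F.module_regular_module])
  interpret K: mod_loc R ?K S using P0 S_sub S_one S_mult by (simp add: mod_loc_def mod_loc_axioms_def)
  let ?P = "loc_module R ?K S" and ?one = "I +> \<one>"
  have one_c: "?one \<in> carrier ?K" using ring_hom_closed[OF hom] by simp
  have smult_one: "a \<odot>\<^bsub>?K\<^esub> ?one = I +> a" if "a \<in> carrier R" for a
    using ring_hom_mult[OF hom that R.one_closed] that by simp
  have zero_iff: "I +> a = \<zero>\<^bsub>?K\<^esub> \<longleftrightarrow> a \<in> I" if "a \<in> carrier R" for a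
    using that I.a_rcos_const[of a] I.a_rcos_self[of a] by (auto simp: FactRing_def)
  define k where "k = loc_frac R ?K S ?one \<one>"
  have k: "k \<in> carrier ?P" using K.frac_closed[OF one_c S_one] by (simp add: k_def)
  have "k \<noteq> \<zero>\<^bsub>?P\<^esub>"
  proof
    assume "k = \<zero>\<^bsub>?P\<^esub>"
    then obtain u where u: "u \<in> S" "u \<odot>\<^bsub>?K\<^esub> (\<one> \<odot>\<^bsub>?K\<^esub> ?one) = u \<odot>\<^bsub>?K\<^esub> (\<one> \<odot>\<^bsub>?K\<^esub> \<zero>\<^bsub>?K\<^esub>)"
      unfolding k_def K.loc_zero using K.frac_eq_iff[OF one_c K.M.zero_closed S_one S_one] by blast
    have uR: "u \<in> carrier R" using u(1) by simp
    have "I +> u = \<zero>\<^bsub>?K\<^esub>"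
      using u(2) unfolding K.smult_one[OF one_c] smult_one[OF uR]
        K.smult_r_null[OF R.one_closed] K.smult_r_null[OF uR] .
    then show False using zero_iff[OF uR] u(1) I(2) by blast
  qed
  have ann: "C \<odot>\<^bsub>?P\<^esub> k = \<zero>\<^bsub>?P\<^esub>" if C: "C \<in> loc_ideal I" for C
  proof -
    obtain a s where a: "a \<in> I" "s \<in> S" "C = a \<div> s" using C by (auto simp: loc_ideal_def)
    have aR: "a \<in> carrier R" using a I.a_subset by auto
    have "C \<odot>\<^bsub>?P\<^esub> k = loc_frac R ?K S (a \<odot>\<^bsub>?K\<^esub> ?one) (s \<otimes> \<one>)"
      unfolding a(3) k_def using K.loc_smult[OF aR one_c a(2) S_one] .
    also have "a \<odot>\<^bsub>?K\<^esub> ?one = \<zero>\<^bsub>?K\<^esub>" using smult_one[OF aR] zero_iff[OF aR] a(1) by metis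
    also have "loc_frac R ?K S \<zero>\<^bsub>?K\<^esub> (s \<otimes> \<one>) = \<zero>\<^bsub>?P\<^esub>"
      unfolding K.loc_zero
      by (rule K.frac_eqI[OF K.M.zero_closed K.M.zero_closed S_mult[OF a(2) S_one] S_one])
        (simp only: K.smult_r_null[OF R.one_closed] K.smult_r_null[OF S_carrier[OF S_mult[OF a(2) S_one]]])
    finally show ?thesis .
  qed
  have L: "module ?A ?L" and N: "module ?A ?N" and P: "module ?A ?P"
    by (rule reg.module_loc_module module_loc_module K.module_loc_module)+
  interpret LP: tensor_pair ?A ?L ?P using L P by (simp add: tensor_pair_def)
  interpret NP: tensor_pair ?A ?N ?P using N P by (simp add: tensor_pair_def)
  have V: "loc_map R M S v \<in> linear_maps ?A ?L ?N"
    by (rule reg.loc_map_linear[OF module_axioms v])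
  have e: "\<one> \<div> \<one> \<in> carrier ?L" using reg.frac_closed[of \<one> \<one>] by simp
  have Ve: "loc_map R M S v (\<one> \<div> \<one>) = loc_frac R M S (v \<one>) \<one>"
    using reg.loc_map_frac[OF module_axioms v, of \<one> \<one>] by simp
  have "frag_of (loc_frac R M S (v \<one>) \<one>, k) \<in> tensor_ker ?A ?N ?P"
    by (rule NP.tensor_ideal_smult_zero[OF loc_ideal[OF I(1)] k ann ideal_smult_loc[OF I(1) mem]])
  moreover have "inj_on (tensor_map ?A ?L ?N ?P (loc_map R M S v)) (carrier (tensor ?A ?L ?P))"
    by (rule pure_map_any[OF L N P pure])
  ultimately have ker: "frag_of (\<one> \<div> \<one>, k) \<in> tensor_ker ?A ?L ?P"
    using e k Ve unfolding inj_on_tensor_map_iff[OF L N P V] by simp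
  have cA: "X \<in> carrier ?L \<longleftrightarrow> X \<in> carrier ?A" and aA: "X \<oplus>\<^bsub>?L\<^esub> Y = X \<oplus>\<^bsub>?A\<^esub> Y"
    and mA: "X \<odot>\<^bsub>?L\<^esub> Y = X \<otimes>\<^bsub>?A\<^esub> Y" for X Y
    by (simp_all add: loc_ring_simps)
  \<comment> \<open>The scalar action, which is a map from the tensor product of \<open>S\<^sup>-\<^sup>1R\<close> and \<open>P\<close> to \<open>P\<close>, shows \<open>k = 0\<close>.\<close>
  have "(\<one> \<div> \<one>) \<odot>\<^bsub>?P\<^esub> k \<in> {\<zero>\<^bsub>?P\<^esub>}"
  proof (rule LP.tensor_zero_lift[where g = "smult ?P"])
    show "abelian_group ?P" by (rule LP.P.abelian_group_axioms)
    show "subgroup {\<zero>\<^bsub>?P\<^esub>} (add_monoid ?P)"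
      using group.triv_subgroup[OF LP.P.M.a_group] by simp
  qed (use e k ker in \<open>simp_all add: cA aA mA LP.P.smult_l_distr LP.P.smult_r_distr LP.P.smult_assoc1[symmetric]
      LP.P.M.r_neg a_minus_def LP.M.R.m_comm\<close>)
  moreover have "(\<one> \<div> \<one>) \<odot>\<^bsub>?P\<^esub> k = k" using LP.P.smult_one[OF k] fraction_one by simp
  ultimately show False using \<open>k \<noteq> \<zero>\<^bsub>?P\<^esub>\<close> by simp
qed

text \<open>
  Conversely, suppose \<open>x/1 \<otimes> q = 0\<close> with \<open>x = v(1)\<close> and \<open>q\<close> in some module over the local ring.
  Then \<open>x \<otimes> q = 0\<close> over \<open>R\<close>, so \<open>x \<in> (Ann q) M\<close> by flatness.  If \<open>q\<close> were nonzero, no element outside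
  \<open>p\<close> could annihilate it, as such elements act invertibly; hence \<open>x \<in> p M\<close>.
\<close>

lemma pure_loc_map_if_notin_ideal_smult:
  assumes flat: "flat_module R M" and v: "v \<in> linear_maps R (regular_module R) M"
    and S: "carrier R - p \<subseteq> S" and notin: "v \<one> \<notin> ideal_smult M p"
  shows "pure_map (loc_ring R S) (loc_module R (regular_module R) S) (loc_module R M S)
    (loc_map R M S v)"
proof (rule pure_map_cyclicI)
  let ?A = "loc_ring R S" and ?L = "loc_module R (regular_module R) S" and ?N = "loc_module R M S"
  show L: "module ?A ?L" and N: "module ?A ?N"
    by (rule reg.module_loc_module module_loc_module)+
  show "loc_map R M S v \<in> linear_maps ?A ?L ?N"
    by (rule reg.loc_map_linear[OF module_axioms v])
  show "\<one> \<div> \<one> \<in> carrier ?L" using reg.frac_closed[of \<one> \<one>] by simp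
  show "\<exists>X\<in>carrier ?A. Y = X \<odot>\<^bsub>?L\<^esub> (\<one> \<div> \<one>)" if "Y \<in> carrier ?L" for Y
  proof (rule bexI)
    show Y: "Y \<in> carrier ?A" using that by (simp add: loc_ring_simps)
    interpret A: cring ?A by (rule cring_loc_ring)
    have "Y = Y \<otimes>\<^bsub>?A\<^esub> \<one>\<^bsub>?A\<^esub>" using Y by simp
    then show "Y = Y \<odot>\<^bsub>?L\<^esub> (\<one> \<div> \<one>)" by (simp only: loc_ring_simps fraction_one)
  qed
  fix P :: "(('r \<times> 'r) set, ('r \<times> 'r) set univ) module" and q
  assume P: "module ?A P" and q: "q \<in> carrier P"
    and ker: "frag_of (loc_map R M S v (\<one> \<div> \<one>), q) \<in> tensor_ker ?A ?N P"
  interpret P: module ?A P by fact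
  let ?Q = "restrict_scalars (\<lambda>a. a \<div> \<one>) P"
  have Q: "module R ?Q" by (rule module_restrict_scalars[OF R.is_cring loc_ring_hom P])
  have x: "v \<one> \<in> carrier M" using linear_mapsD(1)[OF v, of \<one>] by simp
  have "loc_map R M S v (\<one> \<div> \<one>) = loc_frac R M S (v \<one>) \<one>"
    using reg.loc_map_frac[OF module_axioms v, of \<one> \<one>] by simp
  then have "frag_of (v \<one>, q) \<in> tensor_ker R M ?Q"
    using tensor_zero_of_loc_tensor_zero[OF P x q] ker by simp
  from flat_tensor_zero_imp_mem_annihilator_smult[OF flat Q x _ this] q
  have mem: "v \<one> \<in> ideal_smult M {a \<in> carrier R. a \<odot>\<^bsub>?Q\<^esub> q = \<zero>\<^bsub>?Q\<^esub>}" by simp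
  show "q = \<zero>\<^bsub>P\<^esub>"
  proof (rule ccontr)
    assume q0: "q \<noteq> \<zero>\<^bsub>P\<^esub>"
    have "{a \<in> carrier R. a \<odot>\<^bsub>?Q\<^esub> q = \<zero>\<^bsub>?Q\<^esub>} \<subseteq> p"
    proof (rule subsetI, rule ccontr)
      fix a assume a: "a \<in> {a \<in> carrier R. a \<odot>\<^bsub>?Q\<^esub> q = \<zero>\<^bsub>?Q\<^esub>}" "a \<notin> p"
      then have aS: "a \<in> S" "a \<in> carrier R" using S by auto
      have inv: "(\<one> \<div> a) \<otimes>\<^bsub>?A\<^esub> (a \<div> \<one>) = \<one> \<div> \<one>"
        using aS by (simp add: loc_mult) (rule fraction_eqI, auto)
      have "q = (\<one> \<div> \<one>) \<odot>\<^bsub>P\<^esub> q" using P.smult_one[OF q] fraction_one by simp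
      also have "\<dots> = (\<one> \<div> a) \<odot>\<^bsub>P\<^esub> ((a \<div> \<one>) \<odot>\<^bsub>P\<^esub> q)"
        unfolding inv[symmetric] using aS q by (intro P.smult_assoc1 fraction_closed) auto
      also have "\<dots> = \<zero>\<^bsub>P\<^esub>" using a aS by (simp add: fraction_closed)
      finally show False using q0 by simp
    qed
    then show False using mem notin ideal_smult_mono by blast
  qed
qed

end

text \<open>
  For a flat module, purity at \<open>p\<close> of a map out of \<open>R\<close> depends on the image of \<open>1\<close> alone.
\<close>

lemma pure_locus_regular_eq:
  assumes flat: "flat_module R M" and v: "v \<in> linear_maps R (regular_module R) M"
  shows "pure_locus R (regular_module R) M v = {p \<in> Spec R. v \<one>\<^bsub>R\<^esub> \<notin> ideal_smult M p}"
proof -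
  have M: "module R M" using flat by (simp add: flat_module_def)
  have "pure_map (loc_ring R (carrier R - p)) (loc_module R (regular_module R) (carrier R - p))
      (loc_module R M (carrier R - p)) (loc_map R M (carrier R - p) v)
    \<longleftrightarrow> v \<one>\<^bsub>R\<^esub> \<notin> ideal_smult M p" if p: "primeideal p R" for p
  proof -
    interpret p: primeideal p R by fact
    interpret mod_loc R M "carrier R - p"
      using p.cring_loc_complement M
      by (auto simp: mod_loc_def mod_loc_axioms_def cring_loc_def cring_loc_axioms_def)
    show ?thesis
      using pure_loc_map_imp_notin_ideal_smult[OF v p.is_ideal]
        pure_loc_map_if_notin_ideal_smult[OF flat v, of p] by blast
  qed
  then show ?thesis unfolding pure_locus_def Spec_def by blast
qed


section \<open>Openness of pure loci and least radical ideals\<close>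

context module
begin

text \<open>
  The map \<open>a \<mapsto> a x\<close> takes the value \<open>x\<close> at \<open>1\<close>, so every element of \<open>M\<close> arises as \<open>v(1)\<close>.
\<close>

lemma pure_loci_open_iff:
  assumes flat: "flat_module R M"
  shows "pure_loci_open R M \<longleftrightarrow>
    (\<forall>x\<in>carrier M. \<exists>A\<subseteq>carrier R. \<forall>p\<in>Spec R. x \<in> ideal_smult M p \<longleftrightarrow> A \<subseteq> p)"
proof -
  let ?open = "\<lambda>x. openin (zariski R) {p \<in> Spec R. x \<notin> ideal_smult M p}"
  have "pure_loci_open R M \<longleftrightarrow> (\<forall>v\<in>linear_maps R (regular_module R) M. ?open (v \<one>))"
    unfolding pure_loci_open_def by (rule ball_cong[OF refl]) (simp only: pure_locus_regular_eq[OF flat])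
  also have "\<dots> \<longleftrightarrow> (\<forall>x\<in>carrier M. ?open x)"
  proof
    assume *: "\<forall>v\<in>linear_maps R (regular_module R) M. ?open (v \<one>)"
    show "\<forall>x\<in>carrier M. ?open x"
    proof
      fix x assume x: "x \<in> carrier M"
      have "(\<lambda>a. a \<odot>\<^bsub>M\<^esub> x) \<in> linear_maps R (regular_module R) M"
        using x by (auto simp: linear_maps_def smult_l_distr smult_assoc1)
      from bspec[OF * this] show "?open x" using x by simp
    qed
  next
    assume *: "\<forall>x\<in>carrier M. ?open x"
    show "\<forall>v\<in>linear_maps R (regular_module R) M. ?open (v \<one>)"
    proof
      fix v assume "v \<in> linear_maps R (regular_module R) M"
      then have "v \<one> \<in> carrier M" using linear_mapsD(1) by fastforce
      then show "?open (v \<one>)" by (rule bspec[OF *])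
    qed
  qed
  also have "\<dots> \<longleftrightarrow>
    (\<forall>x\<in>carrier M. \<exists>A\<subseteq>carrier R. \<forall>p\<in>Spec R. x \<in> ideal_smult M p \<longleftrightarrow> A \<subseteq> p)"
    unfolding openin_zariski[OF R.is_cring] by (rule ball_cong[OF refl]) (auto simp: set_eq_iff)
  finally show ?thesis .
qed

lemma least_radical_idealE:
  assumes "has_least_radical_ideals R M" "x \<in> carrier M"
  obtains J where "radical_ideal J R" "J \<subseteq> carrier R" "x \<in> ideal_smult M J"
    "\<And>I. radical_ideal I R \<Longrightarrow> x \<in> ideal_smult M I \<Longrightarrow> J \<subseteq> I"
proof -
  from bspec[OF assms(1)[unfolded has_least_radical_ideals_def] assms(2)]
  obtain J where mem: "J \<in> {I. radical_ideal I R \<and> x \<in> ideal_smult M I}"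
    and least: "\<forall>I\<in>{I. radical_ideal I R \<and> x \<in> ideal_smult M I}. J \<subseteq> I" by (rule bexE)
  then have J: "radical_ideal J R" "x \<in> ideal_smult M J" by simp_all
  show thesis
  proof (rule that[OF J(1) _ J(2)])
    show "J \<subseteq> carrier R"
      using radical_idealD(1)[OF J(1)] by (simp add: additive_subgroup.a_subset ideal.axioms(1))
    show "J \<subseteq> I" if "radical_ideal I R" "x \<in> ideal_smult M I" for I
      by (rule bspec[OF least]) (simp add: that)
  qed
qed

text \<open>
  The least radical ideal \<open>J\<close> with \<open>x \<in> J M\<close> lies in the intersection of any family of radical
  ideals \<open>I\<close> with \<open>x \<in> I M\<close>; in the other direction, distributivity is applied to the family of all such \<open>I\<close>.
\<close>

lemma has_least_radical_ideals_iff_Inter_distrib: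
  "has_least_radical_ideals R M \<longleftrightarrow> radical_Inter_distrib R M"
proof
  assume least: "has_least_radical_ideals R M"
  show "radical_Inter_distrib R M"
    unfolding radical_Inter_distrib_def
  proof (intro allI impI equalityI subsetI)
    fix \<I> x assume \<I>: "\<forall>I\<in>\<I>. radical_ideal I R"
      and x: "x \<in> carrier M \<inter> (\<Inter>I\<in>\<I>. ideal_smult M I)"
    then have xM: "x \<in> carrier M" and xI: "\<And>I. I \<in> \<I> \<Longrightarrow> x \<in> ideal_smult M I" by auto
    obtain J where J: "radical_ideal J R" "J \<subseteq> carrier R" "x \<in> ideal_smult M J"
      "\<And>I. radical_ideal I R \<Longrightarrow> x \<in> ideal_smult M I \<Longrightarrow> J \<subseteq> I"
      by (rule least_radical_idealE[OF least xM]) rule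
    have "J \<subseteq> I" if "I \<in> \<I>" for I by (rule J(4)[OF bspec[OF \<I> that] xI[OF that]])
    then have "J \<subseteq> carrier R \<inter> \<Inter>\<I>" using J(2) by blast
    from subsetD[OF ideal_smult_mono[OF this] J(3)]
    show "x \<in> ideal_smult M (carrier R \<inter> \<Inter>\<I>)" .
  next
    fix \<I> x assume "x \<in> ideal_smult M (carrier R \<inter> \<Inter>\<I>)"
    moreover have "ideal_smult M (carrier R \<inter> \<Inter>\<I>) \<subseteq> carrier M"
      by (rule ideal_smult_carrier) blast
    moreover have "ideal_smult M (carrier R \<inter> \<Inter>\<I>) \<subseteq> ideal_smult M I" if "I \<in> \<I>" for I
      by (rule ideal_smult_mono) (use that in blast)
    ultimately show "x \<in> carrier M \<inter> (\<Inter>I\<in>\<I>. ideal_smult M I)"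
      by (intro IntI INT_I) (rule subsetD; assumption | blast)+
  qed
next
  assume distrib: "radical_Inter_distrib R M"
  show "has_least_radical_ideals R M"
    unfolding has_least_radical_ideals_def
  proof
    fix x assume x: "x \<in> carrier M"
    let ?\<I> = "{I. radical_ideal I R \<and> x \<in> ideal_smult M I}"
    have "x \<in> ideal_smult M (carrier R \<inter> \<Inter>?\<I>)"
    proof -
      have "\<forall>I\<in>?\<I>. radical_ideal I R" by simp
      from distrib[unfolded radical_Inter_distrib_def, rule_format, OF bspec[OF this]]
      have "carrier M \<inter> (\<Inter>I\<in>?\<I>. ideal_smult M I) = ideal_smult M (carrier R \<inter> \<Inter>?\<I>)" .
      moreover have "x \<in> carrier M \<inter> (\<Inter>I\<in>?\<I>. ideal_smult M I)" using x by simp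
      ultimately show ?thesis by simp
    qed
    moreover have "radical_ideal (carrier R \<inter> \<Inter>?\<I>) R" by (rule R.radical_ideal_Inter) simp
    ultimately have "carrier R \<inter> \<Inter>?\<I> \<in> ?\<I>" by simp
    moreover have "\<forall>I\<in>?\<I>. carrier R \<inter> \<Inter>?\<I> \<subseteq> I" by (intro ballI le_infI2 Inter_lower)
    ultimately show "\<exists>J\<in>?\<I>. \<forall>I\<in>?\<I>. J \<subseteq> I" by (rule bexI[rotated])
  qed
qed

text \<open>The least radical ideal \<open>J\<close> with \<open>x \<in> J M\<close> defines the closed set of primes \<open>p\<close> with \<open>x \<in> p M\<close>.\<close>

lemma least_radical_ideals_imp_pure_loci_open:
  assumes flat: "flat_module R M" and least: "has_least_radical_ideals R M"
  shows "pure_loci_open R M"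
  unfolding pure_loci_open_iff[OF flat]
proof
  fix x assume x: "x \<in> carrier M"
  obtain J where J: "radical_ideal J R" "J \<subseteq> carrier R" "x \<in> ideal_smult M J"
    "\<And>I. radical_ideal I R \<Longrightarrow> x \<in> ideal_smult M I \<Longrightarrow> J \<subseteq> I"
    by (rule least_radical_idealE[OF least x]) rule
  have "x \<in> ideal_smult M p \<longleftrightarrow> J \<subseteq> p" if "p \<in> Spec R" for p
  proof
    have "radical_ideal p R" using that primeideal.radical_ideal by (simp add: Spec_def)
    then show "x \<in> ideal_smult M p \<Longrightarrow> J \<subseteq> p" by (rule J(4))
    show "J \<subseteq> p \<Longrightarrow> x \<in> ideal_smult M p" using ideal_smult_mono J(3) by blast
  qed
  then show "\<exists>A\<subseteq>carrier R. \<forall>p\<in>Spec R. x \<in> ideal_smult M p \<longleftrightarrow> A \<subseteq> p" using J(2) by blast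
qed

text \<open>
  The candidate for the least radical ideal is the intersection \<open>J\<close> of all primes \<open>p\<close> with \<open>x \<in> p M\<close>.
  Openness makes every prime containing \<open>J\<close> one of these.  So locally the content of \<open>x\<close> lies in
  every prime containing \<open>J\<close>, hence in the localized radical ideal \<open>J\<close>, and the Ohm-Rush property
  gives \<open>x \<in> J M\<close> locally, therefore globally.
\<close>

lemma pure_loci_open_imp_least_radical_ideals:
  assumes flat: "flat_module R M"
    and OR: "\<And>p. p \<in> Spec R \<Longrightarrow> ohm_rush (loc_ring R (carrier R - p)) (loc_module R M (carrier R - p))"
    and "open": "pure_loci_open R M"
  shows "has_least_radical_ideals R M"
  unfolding has_least_radical_ideals_def
proof
  fix x assume x: "x \<in> carrier M"
  have "\<exists>A\<subseteq>carrier R. \<forall>p\<in>Spec R. x \<in> ideal_smult M p \<longleftrightarrow> A \<subseteq> p"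
    using "open"[unfolded pure_loci_open_iff[OF flat]] x by (rule bspec)
  then obtain A where AR: "A \<subseteq> carrier R" and A: "\<forall>p\<in>Spec R. x \<in> ideal_smult M p \<longleftrightarrow> A \<subseteq> p"
    by (elim exE conjE)
  define J where "J = carrier R \<inter> \<Inter>{p \<in> Spec R. x \<in> ideal_smult M p}"
  have J: "radical_ideal J R"
    unfolding J_def
  proof (rule R.radical_ideal_Inter)
    fix p assume "p \<in> {p \<in> Spec R. x \<in> ideal_smult M p}"
    then show "radical_ideal p R" by (simp add: Spec_def primeideal.radical_ideal)
  qed
  interpret J: ideal J R using radical_idealD(1)[OF J] .
  have AJ: "A \<subseteq> J"
    unfolding J_def
  proof (intro Int_greatest Inter_greatest AR)
    fix p assume "p \<in> {p \<in> Spec R. x \<in> ideal_smult M p}"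
    then show "A \<subseteq> p" using bspec[OF A, of p] by simp
  qed
  have mem_primes: "x \<in> ideal_smult M q" if "primeideal q R" "J \<subseteq> q" for q
    using bspec[OF A, of q] that(1) order_trans[OF AJ that(2)] by (simp add: Spec_def)
  have "x \<in> ideal_smult M J"
  proof (rule mem_ideal_smult_local[OF J.is_ideal x])
    fix p assume p: "primeideal p R"
    interpret p: primeideal p R by fact
    let ?S = "carrier R - p"
    interpret Mp: mod_loc R M ?S
      using p.cring_loc_complement module_axioms
      by (auto simp: mod_loc_def mod_loc_axioms_def cring_loc_def cring_loc_axioms_def)
    let ?x = "loc_frac R M ?S x \<one>"
    let ?C = "module_content (loc_ring R ?S) (loc_module R M ?S) ?x"
    have x1: "?x \<in> carrier (loc_module R M ?S)" using x by (intro Mp.frac_closed Mp.S_one)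
    have C_le: "?C \<subseteq> I" if "ideal I (loc_ring R ?S)" "?x \<in> ideal_smult (loc_module R M ?S) I" for I
      unfolding module_content_def by (rule Inter_lower) (simp add: that)
    show "\<exists>u\<in>?S. u \<odot>\<^bsub>M\<^esub> x \<in> ideal_smult M J"
    proof (rule Mp.ideal_smult_loc_clear_denominators[OF J.is_ideal _ _ x])
      show "?x \<in> ideal_smult (loc_module R M ?S) ?C"
        using OR[of p] p x1 by (simp add: ohm_rush_def Spec_def)
      interpret A: cring "loc_ring R ?S" by (rule Mp.cring_loc_ring)
      interpret L: module "loc_ring R ?S" "loc_module R M ?S" by (rule Mp.module_loc_module)
      show "?C \<subseteq> carrier (loc_ring R ?S)"
        by (rule C_le[OF A.oneideal L.mem_ideal_smult_carrier[OF x1]])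
      fix a s assume a: "a \<in> carrier R" "s \<in> ?S" "Mp.fraction a s \<in> ?C"
      show "\<exists>u\<in>?S. u \<otimes> a \<in> J"
      proof (rule Mp.mem_radical_ideal_up_to_unit[OF J a(1)])
        fix q assume q: "primeideal q R" "J \<subseteq> q" "q \<inter> ?S = {}"
        have iq: "ideal q R" using q(1) by (simp add: primeideal_def)
        have "?C \<subseteq> Mp.loc_ideal q"
          by (rule C_le[OF Mp.loc_ideal[OF iq] Mp.ideal_smult_loc[OF iq mem_primes[OF q(1,2)]]])
        from Mp.mem_loc_ideal_prime[OF q(1,3) a(1,2) subsetD[OF this a(3)]]
        show "a \<in> q" .
      qed
    qed
  qed
  moreover have "J \<subseteq> I" if I: "radical_ideal I R" "x \<in> ideal_smult M I" for I
  proof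
    fix a assume a: "a \<in> J"
    show "a \<in> I"
    proof (rule R.radical_ideal_eq_Inter_primes[OF I(1)])
      show "a \<in> carrier R" using a by (simp add: J_def)
      show "a \<in> q" if "primeideal q R" "I \<subseteq> q" for q
        using a that(1) subsetD[OF ideal_smult_mono[OF that(2)] I(2)] by (simp add: J_def Spec_def)
    qed
  qed
  ultimately show "\<exists>J\<in>{I. radical_ideal I R \<and> x \<in> ideal_smult M I}.
      \<forall>I\<in>{I. radical_ideal I R \<and> x \<in> ideal_smult M I}. J \<subseteq> I"
    using J by (intro bexI[of _ J]) simp_all
qed

end

theorem proposition3p72:
  fixes R :: "'r ring" and M :: "('r, 'm) module"
  assumes "cring R" and "module R M" and "flat_module R M"
  shows "(has_least_radical_ideals R M \<longleftrightarrow> radical_Inter_distrib R M) \<and>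
    (has_least_radical_ideals R M \<longrightarrow> pure_loci_open R M) \<and>
    ((\<forall>p \<in> Spec R. ohm_rush (loc_ring R (carrier R - p)) (loc_module R M (carrier R - p))) \<longrightarrow>
       pure_loci_open R M \<longrightarrow> has_least_radical_ideals R M)"
proof -
  interpret module R M by fact
  show ?thesis
    using has_least_radical_ideals_iff_Inter_distrib
      least_radical_ideals_imp_pure_loci_open[OF assms(3)]
      pure_loci_open_imp_least_radical_ideals[OF assms(3)] by (intro conjI impI) simp_all
qed

end
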